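(* Let $m,n\in\mathbb Z$ with $n\ge |m|\ge 1$ and set $$\sigma(m,n):=(n-1)(n-m)-\gcd(n,m)+1 .$$ Let $p(z)=\sum_{k=m}^n a_kz^k$ be a Laurent polynomial in $\mathcal P_{m,n}$ (so $a_m\ne0$ and $a_n\neq 0$). Then the number of self-intersections of $p$ on $\mathbb T$ is at most $\sigma(m,n)$, with the following exceptions: (a) $p$ can be written as $p(z)=q(z^j)$ for some Laurent polynomial $q$ and some integer $j\notin\{-1,1\}$; (b) $n=-m$ and $|a_n|=|a_m|$. (That is, the bound holds whenever neither (a) nor (b) holds.) Moreover, the upper bound is attained for each pair $(m,n)$ with $n\ge|m|\ge1$ and $n\ne m$: there is $p\in\mathcal P_{m,n}$, in neither of the exceptional cases (a), (b), that has exactly $\sigma(m,n)$ self-intersections on $\mathbb T$.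
   Context: $\mathbb T=\{z\in\mathbb C:|z|=1\}$. For integers $m\le n$, $\mathcal P_{m,n}$ is the set of Laurent polynomials $p(z)=\sum_{k=m}^n a_kz^k$ with complex coefficients such that $a_m\ne0$ and $a_n\ne0$. A self-intersection of $p$ on $\mathbb T$ is a two-point subset $\{z_1,z_2\}\subset\mathbb T$ with $z_1\ne z_2$ and $p(z_1)=p(z_2)$ (so a value attained at exactly $s$ distinct points of $\mathbb T$ contributes $s(s-1)/2$ self-intersections). *)

theory Defs
  imports "HOL-Analysis.Analysis" "HOL-Library.Poly_Mapping"
begin

text \<open>
  A complex Laurent polynomial is a finitely supported coefficient function on the integers,
  i.e. an element of the type \<open>int \<Rightarrow>\<^sub>0 complex\<close>. Its value at \<open>z\<close> is meaningful only for
  \<open>z \<noteq> 0\<close>, since \<open>0 powi k = 0\<close> for negative \<open>k\<close>.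
\<close>
type_synonym laurent_poly = "int \<Rightarrow>\<^sub>0 complex"

definition laurent_eval :: "laurent_poly \<Rightarrow> complex \<Rightarrow> complex" where
  "laurent_eval p z = (\<Sum>k\<in>Poly_Mapping.keys p. Poly_Mapping.lookup p k * z powi k)"

definition laurent_polys :: "int \<Rightarrow> int \<Rightarrow> laurent_poly set" where
  "laurent_polys m n = {p. Poly_Mapping.keys p \<subseteq> {m..n} \<and>
     Poly_Mapping.lookup p m \<noteq> 0 \<and> Poly_Mapping.lookup p n \<noteq> 0}"

definition self_intersections :: "laurent_poly \<Rightarrow> complex set set" where
  "self_intersections p = {{z1, z2} | z1 z2. z1 \<in> sphere 0 1 \<and> z2 \<in> sphere 0 1 \<and>
     z1 \<noteq> z2 \<and> laurent_eval p z1 = laurent_eval p z2}"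

text \<open>The exponent \<open>j\<close> may be zero or negative, but not \<open>1\<close> or \<open>-1\<close>.\<close>
definition power_composite :: "laurent_poly \<Rightarrow> bool" where
  "power_composite p \<longleftrightarrow> (\<exists>(q :: laurent_poly) (j :: int). j \<notin> {-1, 1} \<and>
     (\<forall>z. z \<noteq> 0 \<longrightarrow> laurent_eval p z = laurent_eval q (z powi j)))"

definition balanced_ends :: "int \<Rightarrow> int \<Rightarrow> laurent_poly \<Rightarrow> bool" where
  "balanced_ends m n p \<longleftrightarrow>
     n = - m \<and> cmod (Poly_Mapping.lookup p n) = cmod (Poly_Mapping.lookup p m)"

definition sigma_bound :: "int \<Rightarrow> int \<Rightarrow> int" where
  "sigma_bound m n = (n - 1) * (n - m) - gcd n m + 1"

end

theory Submission
  imports Defs "Jordan_Normal_Form.Determinant"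
begin

text \<open>
  Write two distinct points of the circle as \<open>\<zeta> e\<^bsup>it\<^esup>\<close> and \<open>\<zeta> e\<^bsup>-it\<^esup>\<close> with \<open>0 < t < \<pi>\<close>; each
  unordered pair arises from exactly two pairs \<open>(t, \<zeta>)\<close>. With \<open>x = cos t\<close> they have the same image
  under \<open>p\<close> iff \<open>\<Sum>k. a\<^sub>k U\<^bsub>k-1\<^esub>(x) \<zeta>\<^sup>k = 0\<close>. Since \<open>|\<zeta>| = 1\<close>, conjugating gives a second polynomial equation
  for \<open>\<zeta>\<close>, and the resultant of the two is a polynomial in \<open>x\<close> of degree exactly \<open>2 (n-1) (n-m)\<close>,
  unless case (b) holds. Its order at \<open>x\<close> is at least the number of common roots \<open>\<zeta>\<close>, counting \<open>0\<close> and
  \<open>\<infinity>\<close>, which are common roots at the \<open>gcd n m - 1\<close> common zeros of \<open>sin (n t)\<close> and \<open>sin (m t)\<close>.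
  This gives the upper bound.

  The bound is attained by \<open>z\<^sup>n + z\<^sup>m / 8 + \<epsilon> z\<^bsup>m+1\<^esup>\<close> for small \<open>\<epsilon> > 0\<close>: with \<open>N = n - m\<close>, on either side of
  each zero of \<open>sin (n t)\<close> in \<open>(0, \<pi>)\<close> there are \<open>N\<close> solutions \<open>(t, \<zeta>)\<close> if \<open>sin (m t)\<close> does not vanish
  there, and \<open>N - 1\<close> if it does. They are located by the Poincare-Miranda theorem.
\<close>

subsection \<open>Order of vanishing of a polynomial determinant\<close>

lemma coeff_mult_top:
  fixes p q :: "'a::comm_semiring_0 poly"
  assumes "degree p \<le> a" "degree q \<le> b"
  shows "coeff (p * q) (a + b) = coeff p a * coeff q b"
proof -
  have "coeff (p * q) (a + b) = (\<Sum>i\<le>a+b. coeff p i * coeff q (a + b - i))"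
    by (rule coeff_mult)
  also have "\<dots> = (\<Sum>i\<in>{a}. coeff p i * coeff q (a + b - i))"
  proof (rule sum.mono_neutral_right)
    show "\<forall>i\<in>{..a + b} - {a}. coeff p i * coeff q (a + b - i) = 0"
    proof
      fix i assume i: "i \<in> {..a + b} - {a}"
      then consider "i > a" | "a + b - i > b" by force
      then show "coeff p i * coeff q (a + b - i) = 0"
        using assms by cases (simp_all add: coeff_eq_0)
    qed
  qed auto
  finally show ?thesis by simp
qed

lemma coeff_prod_top:
  fixes f :: "'i \<Rightarrow> 'a::comm_semiring_1 poly"
  assumes "finite A" "\<And>i. i \<in> A \<Longrightarrow> degree (f i) \<le> k"
  shows "degree (prod f A) \<le> k * card A \<and> coeff (prod f A) (k * card A) = (\<Prod>i\<in>A. coeff (f i) k)"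
  using assms
proof (induction A rule: finite_induct)
  case (insert a A)
  then have IH: "degree (prod f A) \<le> k * card A" "coeff (prod f A) (k * card A) = (\<Prod>i\<in>A. coeff (f i) k)"
    by auto
  have "degree (f a * prod f A) \<le> k + k * card A"
    using degree_mult_le[of "f a" "prod f A"] IH(1) insert.prems[of a] by simp
  with insert IH show ?case
    using coeff_mult_top[of "f a" k "prod f A" "k * card A"] by simp
qed simp

text \<open>In the Leibniz formula each term is a product of \<open>N\<close> entries of degree at
  most \<open>k\<close>, so its coefficient at \<open>k * N\<close> is the product of the entries'
  coefficients at \<open>k\<close>.\<close>

lemma coeff_det_top:
  fixes A :: "'a::comm_ring_1 poly mat"
  assumes A: "A \<in> carrier_mat N N" and deg: "\<And>i j. i < N \<Longrightarrow> j < N \<Longrightarrow> degree (A $$ (i,j)) \<le> k"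
  shows "coeff (Determinant.det A) (k * N) = Determinant.det (map_mat (\<lambda>p. coeff p k) A)"
proof -
  have "coeff (signof p * (\<Prod>i = 0..<N. A $$ (i, p i))) (k * N) =
        signof p * (\<Prod>i = 0..<N. map_mat (\<lambda>p. coeff p k) A $$ (i, p i))"
    if p: "p permutes {0..<N}" for p
  proof -
    have pi: "p i < N" if "i < N" for i
      using permutes_in_image[OF p, of i] that by simp
    have "coeff (\<Prod>i = 0..<N. A $$ (i, p i)) (k * N) = (\<Prod>i = 0..<N. coeff (A $$ (i, p i)) k)"
      using coeff_prod_top[of "{0..<N}" "\<lambda>i. A $$ (i, p i)" k] deg pi by auto
    also have "\<dots> = (\<Prod>i = 0..<N. map_mat (\<lambda>p. coeff p k) A $$ (i, p i))"
      using A pi by (intro prod.cong) auto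
    finally show ?thesis by (simp add: sign_def)
  qed
  moreover have "map_mat (\<lambda>p. coeff p k) A \<in> carrier_mat N N" using A by simp
  ultimately show ?thesis
    by (simp add: det_def'[OF A] det_def'[of "map_mat (\<lambda>p. coeff p k) A" N] coeff_sum)
qed

text \<open>Every Leibniz term takes exactly one entry from each column of \<open>K\<close>, and
  each of these contributes a factor \<open>q\<close>.\<close>

lemma power_dvd_det_of_dvd_cols:
  fixes A :: "'a::comm_ring_1 mat"
  assumes A: "A \<in> carrier_mat N N" and K: "K \<subseteq> {0..<N}"
    and dvd: "\<And>i j. i < N \<Longrightarrow> j \<in> K \<Longrightarrow> q dvd A $$ (i,j)"
  shows "q ^ card K dvd Determinant.det A"
proof -
  have "q ^ card K dvd (\<Prod>i = 0..<N. A $$ (i, p i))" if p: "p permutes {0..<N}" for p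
  proof -
    define L where "L = {i \<in> {0..<N}. p i \<in> K}"
    have "bij_betw p L K"
      unfolding bij_betw_def
    proof
      show "inj_on p L" using permutes_inj[OF p] by (simp add: inj_on_def)
      show "p ` L = K"
      proof
        show "K \<subseteq> p ` L"
        proof
          fix x assume "x \<in> K"
          then obtain y where "y \<in> {0..<N}" "x = p y"
            using K permutes_image[OF p] by blast
          with \<open>x \<in> K\<close> show "x \<in> p ` L" by (auto simp: L_def)
        qed
      qed (auto simp: L_def)
    qed
    then have "q ^ card K = (\<Prod>i\<in>L. q)" by (simp add: bij_betw_same_card)
    also have "\<dots> dvd (\<Prod>i\<in>L. A $$ (i, p i))"
      by (rule prod_dvd_prod) (auto simp: L_def dvd)
    also have "\<dots> dvd (\<Prod>i = 0..<N. A $$ (i, p i))"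
      by (rule prod_dvd_prod_subset) (auto simp: L_def)
    finally show ?thesis .
  qed
  then show ?thesis
    unfolding det_def'[OF A] by (intro dvd_sum dvd_mult) auto
qed

text \<open>Right multiplication by the constant matrix \<open>B\<close> changes the determinant
  only by a nonzero scalar, and it makes the columns in \<open>K\<close> vanish at \<open>x\<close>.
  Thus independent kernel vectors of \<open>M\<close> at \<open>x\<close> bound the order of the
  determinant there from below.\<close>

lemma root_power_dvd_det:
  fixes M :: "complex poly mat" and B :: "complex mat"
  assumes M: "M \<in> carrier_mat N N" and B: "B \<in> carrier_mat N N" and B0: "Determinant.det B \<noteq> 0"
    and K: "K \<subseteq> {0..<N}"
    and ker: "\<And>i j. i < N \<Longrightarrow> j \<in> K \<Longrightarrow> (\<Sum>k<N. poly (M $$ (i,k)) x * B $$ (k,j)) = 0"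
  shows "[:-x, 1:] ^ card K dvd Determinant.det M"
proof -
  interpret h: comm_ring_hom "\<lambda>c::complex. [:c:]"
    by unfold_locales (auto simp: one_pCons)
  define B' where "B' = map_mat (\<lambda>c. [:c:]) B"
  have B': "B' \<in> carrier_mat N N" using B by (simp add: B'_def)
  have "[:-x, 1:] dvd (M * B') $$ (i,j)" if "i < N" "j \<in> K" for i j
  proof -
    have j: "j < N" using K that by auto
    have "(M * B') $$ (i,j) = (\<Sum>k<N. M $$ (i,k) * [:B $$ (k,j):])"
      using that j M B
      by (simp add: B'_def scalar_prod_def atLeast0LessThan)
    then have "poly ((M * B') $$ (i,j)) x = 0"
      using ker[OF that] by (simp add: poly_sum mult.commute)
    then show ?thesis by (simp add: poly_eq_0_iff_dvd)
  qed
  then have "[:-x, 1:] ^ card K dvd Determinant.det (M * B')"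
    using M B' K by (intro power_dvd_det_of_dvd_cols[where N=N]) auto
  also have "Determinant.det (M * B') = Determinant.det M * Determinant.det B'"
    using M B' by (rule det_mult)
  also have "Determinant.det B' = [:Determinant.det B:]"
    unfolding B'_def by (rule h.hom_det)
  finally have "[:-x, 1:] ^ card K dvd Determinant.det M * [:Determinant.det B:]"
    by simp
  then show ?thesis using B0 by (simp add: dvd_smult_iff)
qed

text \<open>\<open>None\<close> is the point at infinity of the projective line.\<close>
definition proj_power :: "nat \<Rightarrow> complex option \<Rightarrow> nat \<Rightarrow> complex" where
  "proj_power N w k = (case w of Some z \<Rightarrow> z ^ k | None \<Rightarrow> if Suc k = N then 1 else 0)"

text \<open>A polynomial of degree below \<open>N\<close> with \<open>N\<close> zeros on the
  projective line is zero; vanishing at infinity means that the coefficient of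
  \<open>z ^ (N - 1)\<close> is zero. This is Vandermonde independence including the point at
  infinity.\<close>

lemma proj_power_vanish:
  assumes W: "finite W" "card W \<ge> N" and van: "\<And>w. w \<in> W \<Longrightarrow> (\<Sum>k<N. v k * proj_power N w k) = 0"
    and k: "k < N"
  shows "v k = 0"
proof -
  define P where "P = (\<Sum>k<N. monom (v k) k)"
  have coeffP: "coeff P j = (if j < N then v j else 0)" for j
    by (simp add: P_def coeff_sum)
  have polyP: "poly P z = (\<Sum>k<N. v k * z ^ k)" for z
    by (simp add: P_def poly_sum poly_monom)
  define Z where "Z = {z. Some z \<in> W}"
  have W_eq: "W = Some ` Z \<union> (W \<inter> {None})"
    unfolding Z_def by (auto simp: image_iff) (metis not_None_eq)
  have finZ: "finite Z"
    using W(1) finite_vimageI[of W Some] by (simp add: Z_def vimage_def)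
  have root: "poly P z = 0" if "z \<in> Z" for z
    using van[of "Some z"] that by (simp add: Z_def polyP proj_power_def)
  have N: "N > 0" using k by simp
  have "P = 0"
  proof (rule ccontr)
    assume P0: "P \<noteq> 0"
    have "card Z \<le> card {z. poly P z = 0}"
      using root poly_roots_finite[OF P0] by (intro card_mono) auto
    also have "\<dots> \<le> degree P" by (rule card_poly_roots_bound[OF P0])
    finally have cZ: "card Z \<le> degree P" .
    have degP: "degree P < N"
      using coeffP N by (metis P0 leading_coeff_0_iff)
    show False
    proof (cases "None \<in> W")
      case False
      then have "card W = card Z"
        using W_eq by (metis Int_insert_right_if0 Int_empty_right Un_empty_right card_image inj_Some)
      then show False using W(2) cZ degP by simp
    next
      case True
      then have "card W \<le> card Z + 1"
        using W_eq finZ by (metis Int_insert_right_if1 Int_empty_right One_nat_def card_Un_le card_image inj_Some card.empty card.insert finite.emptyI empty_iff)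
      \<comment> \<open>The point at infinity leaves one finite root fewer, but it also lowers the
        degree bound by one.\<close>
      moreover have "degree P \<noteq> N - 1"
      proof
        assume "degree P = N - 1"
        then have "v (N - 1) \<noteq> 0" using P0 coeffP N
          by (metis leading_coeff_0_iff diff_less less_one)
        moreover have "(\<Sum>k<N. v k * proj_power N None k) = v (N - 1)"
        proof -
          have "(\<Sum>k<N. v k * proj_power N None k) = (\<Sum>k\<in>{N-1}. v k * proj_power N None k)"
            using N by (intro sum.mono_neutral_right) (auto simp: proj_power_def)
          then show ?thesis using N by (simp add: proj_power_def)
        qed
        ultimately show False using van[OF True] by simp
      qed
      ultimately show False using W(2) cZ degP by simp
    qed
  qed
  then show ?thesis using coeffP[of k] k by simp
qed

text \<open>Vectors of powers at distinct points are independent, so a set \<open>W\<close> of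
  common roots gives \<open>card W\<close> independent kernel vectors at \<open>x\<close>.\<close>

lemma root_power_dvd_det_proj_power:
  fixes M :: "complex poly mat"
  assumes M: "M \<in> carrier_mat N N" and W: "finite W" "card W \<le> N"
    and ker: "\<And>i w. i < N \<Longrightarrow> w \<in> W \<Longrightarrow> (\<Sum>k<N. poly (M $$ (i,k)) x * proj_power N w k) = 0"
  shows "[:-x, 1:] ^ card W dvd Determinant.det M"
proof -
  have "infinite (UNIV :: complex option set)"
    by (simp add: infinite_UNIV_char_0)
  \<comment> \<open>Arbitrary further points complete \<open>W\<close> to \<open>N\<close> points,
    so that the power vectors form an invertible square matrix \<open>B\<close>.\<close>
  then obtain V where V: "finite V" "card V = N - card W" "V \<subseteq> UNIV - W"
    using infinite_arbitrarily_large[of "UNIV - W" "N - card W"] W(1) by (metis finite_Diff2)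
  define W' where "W' = W \<union> V"
  have W': "W \<subseteq> W'" "finite W'" "card W' = N"
    using V W card_Un_disjoint[of W V] by (auto simp: W'_def)
  obtain ws where ws: "bij_betw ws {0..<N} W'"
    using ex_bij_betw_nat_finite[OF W'(2)] W'(3) by auto
  define B where "B = Matrix.mat N N (\<lambda>(k, j). proj_power N (ws j) k)"
  define K where "K = {j \<in> {0..<N}. ws j \<in> W}"
  have B: "B \<in> carrier_mat N N" by (simp add: B_def)
  have "Determinant.det (transpose_mat B) \<noteq> 0"
  proof
    assume "Determinant.det (transpose_mat B) = 0"
    then obtain v where v: "v \<in> carrier_vec N" "v \<noteq> 0\<^sub>v N" "transpose_mat B *\<^sub>v v = 0\<^sub>v N"
      using det_0_iff_vec_prod_zero[of "transpose_mat B" N] B by auto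
    have "(\<Sum>k<N. vec_index v k * proj_power N w k) = 0" if "w \<in> W'" for w
    proof -
      have "w \<in> ws ` {0..<N}" using ws that by (simp add: bij_betw_def)
      then obtain j where j: "j < N" "ws j = w" by auto
      have "vec_index (transpose_mat B *\<^sub>v v) j = (\<Sum>k<N. proj_power N w k * vec_index v k)"
        using j v(1) by (simp add: B_def scalar_prod_def atLeast0LessThan)
      then show ?thesis using v(3) j(1) by (simp add: mult.commute)
    qed
    then have "vec_index v k = 0" if "k < N" for k
      using proj_power_vanish[of W' N "vec_index v"] W' that by auto
    then show False using v by auto
  qed
  then have "Determinant.det B \<noteq> 0" using B by (simp add: det_transpose)
  moreover have "(\<Sum>k<N. poly (M $$ (i,k)) x * B $$ (k,j)) = 0" if "i < N" "j \<in> K" for i j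
    using ker[of i "ws j"] that by (simp add: K_def B_def)
  moreover have "card K = card W"
  proof (rule bij_betw_same_card[of ws])
    show "bij_betw ws K W"
      using ws W'(1) unfolding bij_betw_def K_def by (auto simp: inj_on_def)
  qed
  moreover have "K \<subseteq> {0..<N}" by (auto simp: K_def)
  ultimately show ?thesis
    using root_power_dvd_det[of M N B K x] M B by metis
qed

subsection \<open>The resultant bound\<close>

text \<open>The Chebyshev polynomials of the second kind, shifted: \<open>cheb k = U\<^bsub>k-1\<^esub>\<close>.\<close>
fun cheb :: "nat \<Rightarrow> complex poly" where
  "cheb 0 = 0"
| "cheb (Suc 0) = 1"
| "cheb (Suc (Suc k)) = [:0, 2:] * cheb (Suc k) - cheb k"

lemma poly_cheb: "poly (cheb k) (of_real (cos t)) * of_real (sin t) = of_real (sin (real k * t))"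
proof (induction k rule: cheb.induct)
  case (3 k)
  have eq: "sin (real (Suc (Suc k)) * t) = 2 * cos t * sin (real (Suc k) * t) - sin (real k * t)"
    using sin_add[of "real (Suc k) * t" t] sin_diff[of "real (Suc k) * t" t]
    by (simp add: algebra_simps)
  have "poly (cheb (Suc (Suc k))) (of_real (cos t)) * of_real (sin t) =
      2 * of_real (cos t) * (poly (cheb (Suc k)) (of_real (cos t)) * of_real (sin t))
      - poly (cheb k) (of_real (cos t)) * of_real (sin t)"
    by (simp add: algebra_simps)
  then show ?case unfolding 3 eq by simp
qed auto

lemma degree_cheb: "degree (cheb k) \<le> k - 1"
proof (induction k rule: cheb.induct)
  case (3 k)
  have "degree ([:0, 2:] * cheb (Suc k)) \<le> Suc k"
    using degree_mult_le[of "[:0, 2:]" "cheb (Suc k)"] 3(1) by simp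
  then show ?case using 3(2) by (auto intro!: degree_diff_le)
qed auto

lemma coeff_cheb: "coeff (cheb (Suc k)) k = 2 ^ k"
proof (induction k)
  case (Suc k)
  have "coeff (cheb k) (Suc k) = 0"
    by (rule coeff_eq_0) (use degree_cheb[of k] in linarith)
  then show ?case using Suc by (simp add: coeff_pCons)
qed auto

text \<open>The extension to negative indices is odd, as \<open>sin (k * t) / sin t\<close> is odd
  in \<open>k\<close>.\<close>

definition chebi :: "int \<Rightarrow> complex poly" where
  "chebi k = (if k \<ge> 0 then cheb (nat k) else - cheb (nat (- k)))"

lemma poly_chebi: "poly (chebi k) (of_real (cos t)) * of_real (sin t) = of_real (sin (of_int k * t))"
  using poly_cheb[of "nat k" t] poly_cheb[of "nat (- k)" t] by (auto simp: chebi_def)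

lemma degree_chebi: "degree (chebi k) \<le> nat \<bar>k\<bar> - 1"
  using degree_cheb[of "nat k"] degree_cheb[of "nat (- k)"] by (auto simp: chebi_def)

lemma coeff_chebi_pos: "k > 0 \<Longrightarrow> coeff (chebi k) (nat k - 1) = 2 ^ (nat k - 1)"
  using coeff_cheb[of "nat k - 1"] by (simp add: chebi_def)

lemma chebi_uminus: "chebi (- k) = - chebi k"
  by (auto simp: chebi_def)

lemma coeff_chebi_small: "\<bar>k\<bar> < n \<Longrightarrow> coeff (chebi k) (nat n - 1) = 0"
  using degree_chebi[of k] by (cases "k = 0") (auto simp: chebi_def intro!: coeff_eq_0)

lemma poly_chebi_0_iff:
  assumes "0 < t" "t < pi"
  shows "poly (chebi k) (of_real (cos t)) = 0 \<longleftrightarrow> sin (of_int k * t) = 0"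
  using poly_chebi[of k t] sin_gt_zero[OF assms]
  by (metis less_numeral_extra(3) mult_eq_0_iff of_real_eq_0_iff)

text \<open>Factoring out \<open>z powi lo\<close> turns a Laurent sum supported in a window of
  length \<open>N\<close> into a sum over the columns of an \<open>N\<close> by \<open>N\<close>
  matrix. The set \<open>K\<close> may be any finite set containing the support.\<close>

lemma sum_shift_powi:
  fixes c :: "int \<Rightarrow> complex"
  assumes supp: "\<And>k. c k \<noteq> 0 \<Longrightarrow> k \<in> {lo..<lo + int N}" and z: "z \<noteq> 0"
    and fin: "finite K" and K: "\<And>k. c k \<noteq> 0 \<Longrightarrow> k \<in> K"
  shows "(\<Sum>j<N. c (lo + int j) * z ^ j) = z powi (- lo) * (\<Sum>k\<in>K. c k * z powi k)"
proof -
  have bij: "bij_betw (\<lambda>j. lo + int j) {..<N} {lo..<lo + int N}"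
    by (rule bij_betwI[of _ _ _ "\<lambda>k. nat (k - lo)"]) auto
  have "(\<Sum>j<N. c (lo + int j) * z ^ j) = (\<Sum>j<N. z powi (- lo) * (c (lo + int j) * z powi (lo + int j)))"
    using z by (intro sum.cong) (auto simp: power_int_add power_int_minus)
  also have "\<dots> = (\<Sum>k\<in>{lo..<lo + int N}. z powi (- lo) * (c k * z powi k))"
    by (rule sum.reindex_bij_betw[OF bij])
  also have "\<dots> = (\<Sum>k\<in>K. z powi (- lo) * (c k * z powi k))"
    by (rule sum.mono_neutral_cong) (use supp K fin in auto)
  finally show ?thesis by (simp add: sum_distrib_left)
qed

text \<open>
  The pair \<open>(t, \<zeta>)\<close> stands for the points \<open>\<zeta> e\<^bsup>it\<^esup>\<close> and \<open>\<zeta> e\<^bsup>-it\<^esup>\<close> of the circle, and the sum is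
  the difference of the values of \<open>p\<close> there, divided by \<open>2i\<close>.
\<close>
definition chord_solutions :: "laurent_poly \<Rightarrow> (real \<times> complex) set" where
  "chord_solutions p = {(t, \<zeta>). 0 < t \<and> t < pi \<and> \<zeta> \<in> sphere 0 1 \<and>
     (\<Sum>k\<in>Poly_Mapping.keys p. Poly_Mapping.lookup p k * \<zeta> powi k * of_real (sin (of_int k * t))) = 0}"

text \<open>The assumption \<open>nonvanishing\<close> says that for no \<open>t\<close> is the
  chord equation trivial in \<zeta>; \<open>power_composite_iff\<close> identifies this with the
  failure of case (a). The monomial case \<open>m = n\<close>, where the Sylvester matrix would be
  empty, is treated separately.\<close>

locale chord_system =
  fixes m n :: int and p :: laurent_poly
  assumes mn: "n \<ge> \<bar>m\<bar>" "\<bar>m\<bar> \<ge> 1" and p: "p \<in> laurent_polys m n"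
    and nonvanishing: "\<And>t. 0 < t \<Longrightarrow> t < pi \<Longrightarrow> \<exists>k\<in>Poly_Mapping.keys p. sin (of_int k * t) \<noteq> 0"
    and unbalanced: "\<not> balanced_ends m n p" and neq: "m \<noteq> n"
begin

abbreviation "a \<equiv> Poly_Mapping.lookup p"

definition "d = nat (n - m)"
definition "N = 2 * d"

lemma d: "int d = n - m" "d > 0" "N > 0"
  using mn neq by (auto simp: d_def N_def)

lemma n: "n > 0" using mn by simp

lemma a_supp: "a k \<noteq> 0 \<Longrightarrow> k \<in> {m..n}"
  using p by (auto simp: laurent_polys_def in_keys_iff subset_iff)

lemma a_out: "k < m \<or> k > n \<Longrightarrow> a k = 0"
  using a_supp by (metis atLeastAtMost_iff not_less)

lemma a_ends: "a m \<noteq> 0" "a n \<noteq> 0"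
  using p by (auto simp: laurent_polys_def)

text \<open>Later rows carry the conjugated coefficients in reversed order, because conjugation
  inverts \<zeta> on the circle.\<close>

definition entry :: "nat \<Rightarrow> nat \<Rightarrow> complex poly" where
  "entry i j = (if i < d then Polynomial.smult (a (m - int i + int j)) (chebi (m - int i + int j))
     else Polynomial.smult (cnj (a (n + int (i - d) - int j))) (chebi (n + int (i - d) - int j)))"

text \<open>
  The Sylvester matrix, with respect to \<open>\<zeta>\<close>, of the polynomial
  \<open>\<Sum>k. a\<^sub>k U\<^bsub>k-1\<^esub>(x) \<zeta>\<^bsup>k-m\<^esup>\<close> and its reciprocal conjugate, where \<open>x = cos t\<close>.
\<close>
definition "sylv = Matrix.mat N N (\<lambda>(i, j). entry i j)"

lemma sylv: "sylv \<in> carrier_mat N N" "i < N \<Longrightarrow> j < N \<Longrightarrow> sylv $$ (i, j) = entry i j"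
  by (auto simp: sylv_def)

lemma degree_entry: "degree (entry i j) \<le> nat n - 1"
proof -
  have *: "degree (Polynomial.smult b (chebi k)) \<le> nat n - 1" if "b \<noteq> 0 \<Longrightarrow> k \<in> {m..n}" for b k
  proof (cases "b = 0")
    case False
    then have "\<bar>k\<bar> \<le> n" using that mn by auto
    then have "nat \<bar>k\<bar> - 1 \<le> nat n - 1" by simp
    then show ?thesis using degree_chebi[of k] False by simp
  qed simp
  show ?thesis unfolding entry_def using * a_supp by auto
qed

text \<open>Only the indices \<open>n\<close> and \<open>- n\<close> reach degree
  \<open>n - 1\<close>, with leading coefficient \<open>2 ^ (n - 1)\<close> up to sign. The index
  \<open>- n\<close> is in range only if \<open>m = - n\<close>, and its sign comes from the oddness
  of \<open>chebi\<close>.\<close>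

lemma coeff_scaled_chebi:
  assumes "\<And>k. b k \<noteq> 0 \<Longrightarrow> k \<in> {m..n}"
  shows "coeff (Polynomial.smult (b k) (chebi k)) (nat n - 1) =
     2 ^ (nat n - 1) * (if k = n then b n else if m = - n \<and> k = - n then - b m else 0)"
proof (cases "b k = 0")
  case False
  then have k: "k \<in> {m..n}" "\<bar>k\<bar> \<le> n" using assms[of k] mn by auto
  then consider "k = n" | "k = - n" "k \<noteq> n" "m = - n" | "\<bar>k\<bar> < n" using mn by fastforce
  then show ?thesis
    using n by cases (auto simp: coeff_chebi_pos chebi_uminus coeff_chebi_small simp del: One_nat_def)
qed auto

text \<open>At top degree row \<open>i\<close> involves only columns \<open>i\<close> and its
  partner, \<open>i + d\<close> or \<open>i - d\<close>.\<close>

lemma coeff_entry: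
  assumes "i < N" "j < N"
  shows "coeff (entry i j) (nat n - 1) = 2 ^ (nat n - 1) *
    (if i < d then (if j = i + d then a n else if m = - n \<and> j = i then - a m else 0)
     else (if j = i - d then cnj (a n) else if m = - n \<and> j = i then - cnj (a m) else 0))"
proof (cases "i < d")
  case True
  have 1: "m - int i + int j = n \<longleftrightarrow> j = i + d" and 2: "m = - n \<and> m - int i + int j = - n \<longleftrightarrow> m = - n \<and> j = i"
    using d by auto
  have "coeff (entry i j) (nat n - 1) =
      2 ^ (nat n - 1) * (if j = i + d then a n else if m = - n \<and> j = i then - a m else 0)"
    using coeff_scaled_chebi[of a "m - int i + int j", OF a_supp]
    unfolding entry_def if_P[OF True] 1 2 by blast
  then show ?thesis using True by (simp only: if_True)
next
  case False
  have 1: "n + int (i - d) - int j = n \<longleftrightarrow> j = i - d"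
    and 2: "m = - n \<and> n + int (i - d) - int j = - n \<longleftrightarrow> m = - n \<and> j = i"
    using d False by auto
  have supp': "k \<in> {m..n}" if "cnj (a k) \<noteq> 0" for k
    by (rule a_supp) (use that in simp)
  have "coeff (entry i j) (nat n - 1) =
      2 ^ (nat n - 1) * (if j = i - d then cnj (a n) else if m = - n \<and> j = i then - cnj (a m) else 0)"
    unfolding entry_def if_not_P[OF False]
    using coeff_scaled_chebi[of "\<lambda>k. cnj (a k)" "n + int (i - d) - int j", OF supp']
    unfolding 1 2 by blast
  then show ?thesis using False by (simp only: if_False)
qed

text \<open>The matrix of top coefficients decouples into \<open>d\<close> systems in the unknowns
  \<open>x i\<close> and \<open>x (i + d)\<close>. If \<open>m = - n\<close>, each has determinant
  \<open>|a n|^2 - |a m|^2\<close> up to a nonzero factor, which is nonzero as the ends are not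
  balanced. Otherwise only the nonzero entries \<open>a n\<close> and its conjugate remain.\<close>

lemma det_top_nonzero: "coeff (Determinant.det sylv) ((nat n - 1) * N) \<noteq> 0"
proof
  define L where "L = map_mat (\<lambda>q. coeff q (nat n - 1)) sylv"
  have L: "L \<in> carrier_mat N N" using sylv by (simp add: L_def)
  assume "coeff (Determinant.det sylv) ((nat n - 1) * N) = 0"
  then have "Determinant.det L = 0"
    using coeff_det_top[OF sylv(1), of "nat n - 1"] degree_entry sylv(2) by (simp add: L_def)
  then obtain v where v: "v \<in> carrier_vec N" "v \<noteq> 0\<^sub>v N" "L *\<^sub>v v = 0\<^sub>v N"
    using det_0_iff_vec_prod_zero[OF L] by auto
  define x where "x = vec_index v"
  have row: "(\<Sum>j<N. coeff (entry i j) (nat n - 1) * x j) = 0" if "i < N" for i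
  proof -
    have "vec_index (L *\<^sub>v v) i = (\<Sum>j<N. coeff (entry i j) (nat n - 1) * x j)"
      using that v(1) L sylv by (simp add: L_def scalar_prod_def atLeast0LessThan x_def)
    then show ?thesis using v(3) that by simp
  qed
  have two: "(\<Sum>j<N. 2 ^ (nat n - 1) * (if j = j1 then b1 else if P \<and> j = j2 then b2 else 0) * x j) =
      2 ^ (nat n - 1) * (b1 * x j1 + (if P then b2 * x j2 else 0))"
    if "j1 < N" "j2 < N" "j1 \<noteq> j2" for j1 j2 b1 b2 P
  proof -
    have "(\<Sum>j<N. 2 ^ (nat n - 1) * (if j = j1 then b1 else if P \<and> j = j2 then b2 else 0) * x j) =
       (\<Sum>j\<in>{j1,j2}. 2 ^ (nat n - 1) * (if j = j1 then b1 else if P \<and> j = j2 then b2 else 0) * x j)"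
      by (rule sum.mono_neutral_right) (use that in auto)
    also have "\<dots> = 2 ^ (nat n - 1) * (b1 * x j1 + (if P then b2 * x j2 else 0))"
      using that by (auto simp: algebra_simps)
    finally show ?thesis .
  qed
  have eq: "a n * x (i + d) + (if m = - n then - a m * x i else 0) = 0"
           "cnj (a n) * x i + (if m = - n then - cnj (a m) * x (i + d) else 0) = 0" if i: "i < d" for i
  proof -
    have N: "i < N" "i + d < N" "i \<noteq> i + d" "i + d \<noteq> i" using i d by (auto simp: N_def)
    have row1: "coeff (entry i j) (nat n - 1) =
        2 ^ (nat n - 1) * (if j = i + d then a n else if m = - n \<and> j = i then - a m else 0)" if "j < N" for j
      unfolding coeff_entry[OF N(1) that] using i by (simp only: if_True)
    have "(\<Sum>j<N. coeff (entry i j) (nat n - 1) * x j) = 2 ^ (nat n - 1) * (a n * x (i + d) + (if m = - n then - a m * x i else 0))"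
      unfolding two[OF N(2,1,4), symmetric] by (intro sum.cong refl) (simp only: row1 lessThan_iff)
    then show "a n * x (i + d) + (if m = - n then - a m * x i else 0) = 0" using row[OF N(1)] by auto
    have "\<not> i + d < d" "i + d - d = i" by auto
    then have row2: "coeff (entry (i + d) j) (nat n - 1) =
        2 ^ (nat n - 1) * (if j = i then cnj (a n) else if m = - n \<and> j = i + d then - cnj (a m) else 0)" if "j < N" for j
      unfolding coeff_entry[OF N(2) that] by (simp only: if_False)
    have "(\<Sum>j<N. coeff (entry (i + d) j) (nat n - 1) * x j) =
        2 ^ (nat n - 1) * (cnj (a n) * x i + (if m = - n then - cnj (a m) * x (i + d) else 0))"
      unfolding two[OF N(1,2,3), symmetric] by (intro sum.cong refl) (simp only: row2 lessThan_iff)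
    then show "cnj (a n) * x i + (if m = - n then - cnj (a m) * x (i + d) else 0) = 0" using row[OF N(2)] by auto
  qed
  have zero: "x i = 0 \<and> x (i + d) = 0" if i: "i < d" for i
  proof (cases "m = - n")
    case False
    then show ?thesis using eq[OF i] a_ends by auto
  next
    case True
    have e1: "a n * x (i + d) = a m * x i" and e2: "cnj (a n) * x i = cnj (a m) * x (i + d)"
      using eq[OF i] True by auto
    have "(a n * cnj (a n)) * x i = (a m * cnj (a m)) * x i"
      using e1 e2 by (metis mult.assoc mult.left_commute)
    then have "of_real ((cmod (a n))\<^sup>2 - (cmod (a m))\<^sup>2) * x i = 0"
      by (simp add: complex_norm_square[symmetric] algebra_simps)
    moreover have "(cmod (a n))\<^sup>2 \<noteq> (cmod (a m))\<^sup>2"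
      using unbalanced True by (simp add: balanced_ends_def)
    ultimately have "x i = 0" by (metis mult_eq_0_iff of_real_eq_0_iff right_minus_eq)
    then show ?thesis using e1 a_ends by simp
  qed
  have "x i = 0" if "i < N" for i
  proof (cases "i < d")
    case False
    then have "i - d < d" "i = (i - d) + d" using that by (auto simp: N_def)
    then show ?thesis using zero by metis
  qed (use zero in auto)
  then show False using v by (auto simp: x_def)
qed

lemma det_nonzero: "Determinant.det sylv \<noteq> 0"
  using det_top_nonzero by auto

lemma degree_det: "degree (Determinant.det sylv) \<le> (nat n - 1) * N"
  using sylv degree_entry by (intro degree_det_le) auto

section \<open>Common roots as kernel vectors, and their number\<close>

definition "fibre t = {\<zeta>. (t, \<zeta>) \<in> chord_solutions p}"

text \<open>
  Where \<open>sin (n t)\<close> and \<open>sin (m t)\<close> vanish together, both equations in \<open>\<zeta>\<close> also have the spurious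
  roots \<open>0\<close> and \<open>\<infinity>\<close>; these account for the term \<open>gcd n m - 1\<close> of the bound.
\<close>
definition "nodes t = Some ` fibre t \<union> (if sin (of_int n * t) = 0 \<and> sin (of_int m * t) = 0 then {Some 0, None} else {})"

text \<open>Applied to the powers of \<zeta>, a row with \<open>i < d\<close> is a power of \<zeta>
  times the chord equation, and a later row a power of \<zeta> times its conjugate, both up to the
  factor \<open>sin t\<close>.\<close>

lemma kernel_circle:
  assumes \<zeta>: "\<zeta> \<in> fibre t" and i: "i < N"
  shows "(\<Sum>j<N. poly (entry i j) (of_real (cos t)) * \<zeta> ^ j) = 0"
proof -
  define c where "c = (\<lambda>k. a k * of_real (sin (of_int k * t)))"
  have t: "0 < t" "t < pi" and norm: "cmod \<zeta> = 1"
    and sol: "(\<Sum>k\<in>{m..n}. c k * \<zeta> powi k) = 0"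
  proof -
    show "0 < t" "t < pi" "cmod \<zeta> = 1" using \<zeta> by (auto simp: fibre_def chord_solutions_def)
    have "(\<Sum>k\<in>{m..n}. c k * \<zeta> powi k) = (\<Sum>k\<in>Poly_Mapping.keys p. c k * \<zeta> powi k)"
      using p by (intro sum.mono_neutral_right) (auto simp: laurent_polys_def c_def in_keys_iff)
    also have "\<dots> = 0" using \<zeta> by (simp add: fibre_def chord_solutions_def c_def mult_ac)
    finally show "(\<Sum>k\<in>{m..n}. c k * \<zeta> powi k) = 0" .
  qed
  have z: "\<zeta> \<noteq> 0" using norm by auto
  have csupp: "c k \<noteq> 0 \<Longrightarrow> k \<in> {m..n}" for k using a_supp by (auto simp: c_def)
  have s: "complex_of_real (sin t) \<noteq> 0" using sin_gt_zero[OF t] by simp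
  have scaled: "poly (Polynomial.smult b (chebi k)) (of_real (cos t)) * y * of_real (sin t) =
      b * of_real (sin (of_int k * t)) * y" for b k y
    unfolding poly_chebi[symmetric] by (simp add: mult_ac)
  \<comment> \<open>The factor \<open>sin t\<close>, nonzero on the open interval from 0 to
    \<open>pi\<close>, turns \<open>chebi k\<close> at \<open>cos t\<close> into
    \<open>sin (k * t)\<close>.\<close>
  have "(\<Sum>j<N. poly (entry i j) (of_real (cos t)) * \<zeta> ^ j) * of_real (sin t) = 0"
  proof (cases "i < d")
    case True
    have "(\<Sum>j<N. poly (entry i j) (of_real (cos t)) * \<zeta> ^ j) * of_real (sin t) = (\<Sum>j<N. c (m - int i + int j) * \<zeta> ^ j)"
      unfolding sum_distrib_right entry_def if_P[OF True] scaled c_def ..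
    also have "\<dots> = \<zeta> powi (- (m - int i)) * (\<Sum>k\<in>{m..n}. c k * \<zeta> powi k)"
    proof (rule sum_shift_powi)
      fix k assume "c k \<noteq> 0"
      with csupp have "k \<in> {m..n}" by blast
      then show "k \<in> {m - int i..<m - int i + int N}" using True d by (auto simp: N_def)
    qed (use z csupp in auto)
    finally show ?thesis using sol by simp
  next
    case False
    have "\<zeta> * cnj \<zeta> = 1" using complex_norm_square[of \<zeta>] norm by simp
    then have inv: "inverse \<zeta> = cnj \<zeta>" by (rule inverse_unique)
    \<comment> \<open>These are the coefficients of the conjugate equation: conjugating a power of
      \<zeta> negates its exponent.\<close>
    define c' where "c' = (\<lambda>k. cnj (c (- k)))"
    define lo where "lo = - (n + int (i - d))"
    have lo_eq: "n + int (i - d) - int j = - (lo + int j)" for j by (simp add: lo_def)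
    have "(\<Sum>j<N. poly (entry i j) (of_real (cos t)) * \<zeta> ^ j) * of_real (sin t) = (\<Sum>j<N. c' (lo + int j) * \<zeta> ^ j)"
      unfolding sum_distrib_right entry_def if_not_P[OF False] scaled c_def c'_def lo_eq
        complex_cnj_mult complex_cnj_complex_of_real ..
    also have "\<dots> = \<zeta> powi (- lo) * (\<Sum>k\<in>{-n..-m}. c' k * \<zeta> powi k)"
    proof (rule sum_shift_powi)
      fix k assume "c' k \<noteq> 0"
      with csupp[of "- k"] have "- k \<in> {m..n}" by (auto simp: c'_def)
      then show "k \<in> {lo..<lo + int N}" "k \<in> {-n..-m}" using False i d by (auto simp: N_def lo_def)
    qed (use z in auto)
    also have "(\<Sum>k\<in>{-n..-m}. c' k * \<zeta> powi k) = (\<Sum>k\<in>{m..n}. cnj (c k * \<zeta> powi k))"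
    proof (rule sum.reindex_bij_witness[of _ uminus uminus])
      fix k assume "k \<in> {-n..-m}"
      have "cnj (\<zeta> powi (- k)) = \<zeta> powi k"
        by (simp add: inv[symmetric] power_int_inverse power_int_minus)
      then show "cnj (c (- k) * \<zeta> powi - k) = c' k * \<zeta> powi k" by (simp add: c'_def)
    qed auto
    also have "\<dots> = cnj (\<Sum>k\<in>{m..n}. c k * \<zeta> powi k)" by (simp only: cnj_sum)
    finally show ?thesis using sol by simp
  qed
  then show ?thesis using s by simp
qed

text \<open>The power vectors of \<open>0\<close> and of infinity are the first and the last unit
  vector. The corresponding columns contain, besides zeros, only multiples of \<open>chebi m\<close>
  and \<open>chebi n\<close>, which vanish at a common zero of the two sines.\<close>

lemma kernel_nodes:
  assumes t: "0 < t" "t < pi" and w: "w \<in> nodes t" and i: "i < N"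
  shows "(\<Sum>j<N. poly (entry i j) (of_real (cos t)) * proj_power N w j) = 0"
proof -
  consider \<zeta> where "\<zeta> \<in> fibre t" "w = Some \<zeta>"
    | "sin (of_int n * t) = 0" "sin (of_int m * t) = 0" "w = Some 0 \<or> w = None"
    using w by (auto simp: nodes_def split: if_splits)
  then show ?thesis
  proof cases
    case 1
    then show ?thesis using kernel_circle[OF _ i] by (simp add: proj_power_def)
  next
    case 2
    have ends: "poly (chebi n) (of_real (cos t)) = 0" "poly (chebi m) (of_real (cos t)) = 0"
      using 2 poly_chebi_0_iff[OF t] by auto
    have "poly (entry i 0) (of_real (cos t)) = 0"
      using ends a_out[of "m - int i"] a_out[of "n + int (i - d)"]
      by (cases "i = 0"; cases "i = d") (auto simp: entry_def)
    moreover have "poly (entry i (N - 1)) (of_real (cos t)) = 0"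
    proof (cases "i < d")
      case True
      then have "m - int i + int (N - 1) \<ge> n" using d by (auto simp: N_def of_nat_diff)
      then show ?thesis using True ends a_out[of "m - int i + int (N - 1)"]
        by (cases "m - int i + int (N - 1) = n") (auto simp: entry_def)
    next
      case False
      then have "n + int (i - d) - int (N - 1) \<le> m" using d i by (auto simp: N_def of_nat_diff)
      then show ?thesis using False ends a_out[of "n + int (i - d) - int (N - 1)"]
        by (cases "n + int (i - d) - int (N - 1) = m") (auto simp: entry_def)
    qed
    moreover have "proj_power N w j = 0" if "j < N" "j \<noteq> 0" "j \<noteq> N - 1" for j
      using 2(3) that by (auto simp: proj_power_def)
    ultimately have "poly (entry i j) (of_real (cos t)) * proj_power N w j = 0" if "j < N" for j
      using that by (metis mult_eq_0_iff)
    then show ?thesis by (intro sum.neutral ballI) (simp only: lessThan_iff)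
  qed
qed

text \<open>With \<open>N\<close> nodes, row 0 would vanish identically at \<open>cos t\<close>.
  That row contains every coefficient of the chord equation, so this contradicts
  \<open>nonvanishing\<close>.\<close>

lemma nodes_finite:
  assumes t: "0 < t" "t < pi"
  shows "finite (nodes t) \<and> card (nodes t) \<le> N"
proof (rule ccontr)
  assume neg: "\<not> (finite (nodes t) \<and> card (nodes t) \<le> N)"
  obtain W where W: "W \<subseteq> nodes t" "finite W" "card W = N"
  proof (cases "finite (nodes t)")
    case True
    with neg have "N \<le> card (nodes t)" by simp
    then show ?thesis using obtain_subset_with_card_n that True by (metis finite_subset)
  next
    case False
    then show ?thesis using infinite_arbitrarily_large[of "nodes t" N] that by auto
  qed
  have van: "poly (entry 0 j) (of_real (cos t)) = 0" if "j < N" for j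
  proof (rule proj_power_vanish[of W N "\<lambda>j. poly (entry 0 j) (of_real (cos t))"])
    fix w assume "w \<in> W"
    then show "(\<Sum>j<N. poly (entry 0 j) (of_real (cos t)) * proj_power N w j) = 0"
      using W(1) kernel_nodes[OF t, of w 0] d by auto
  qed (use W that in auto)
  obtain k where k: "k \<in> Poly_Mapping.keys p" "sin (of_int k * t) \<noteq> 0"
    using nonvanishing[OF t] by auto
  then have ak: "a k \<noteq> 0" by (simp add: in_keys_iff)
  then have "k \<in> {m..n}" by (rule a_supp)
  then have "nat (k - m) < N" "m + int (nat (k - m)) = k" using d by (auto simp: N_def)
  then have "poly (chebi k) (of_real (cos t)) = 0"
    using van[of "nat (k - m)"] d ak by (simp add: entry_def)
  then show False using k(2) poly_chebi_0_iff[OF t] by simp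
qed

text \<open>The nodes at \<open>t\<close> are bounded in number by the order of the determinant at
  \<open>cos t\<close>, and the orders add up to at most \<open>2 * (n - 1) * (n - m)\<close>.
  Discarding the two spurious nodes at each of at least \<open>gcd n m - 1\<close> common zeros of
  the sines leaves the chord solutions.\<close>

lemma card_chord_solutions_le:
  "finite (chord_solutions p) \<and> int (card (chord_solutions p)) \<le> 2 * sigma_bound m n"
proof -
  define T where "T = {t. 0 < t \<and> t < pi \<and> nodes t \<noteq> {}}"
  define x where "x = (\<lambda>t. complex_of_real (cos t))"
  let ?D = "Determinant.det sylv"
  have ord: "card (nodes t) \<le> order (x t) ?D" if t: "0 < t" "t < pi" for t
  proof -
    have "[:- x t, 1:] ^ card (nodes t) dvd ?D"
      using nodes_finite[OF t] kernel_nodes[OF t] sylv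
      by (intro root_power_dvd_det_proj_power[where N = N]) (auto simp: x_def)
    then show ?thesis using det_nonzero by (simp add: order_divides)
  qed
  have inj: "inj_on x T"
    by (intro inj_onI) (auto simp: T_def x_def intro: cos_inj_pi)
  have xT: "x ` T \<subseteq> {z. poly ?D z = 0}"
  proof safe
    fix t assume t: "t \<in> T"
    then have "card (nodes t) > 0" using nodes_finite[of t] by (auto simp: T_def card_gt_0_iff)
    then have "order (x t) ?D \<noteq> 0" using ord[of t] t by (auto simp: T_def)
    then show "poly ?D (x t) = 0" using det_nonzero by (simp add: order_root)
  qed
  have finT: "finite T"
    using finite_imageD[OF _ inj] finite_subset[OF xT poly_roots_finite[OF det_nonzero]] by blast
  have "(\<Sum>t\<in>T. card (nodes t)) \<le> (\<Sum>t\<in>T. order (x t) ?D)"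
    by (intro sum_mono ord) (auto simp: T_def)
  also have "\<dots> = (\<Sum>z\<in>x ` T. order z ?D)"
    by (simp add: sum.reindex[OF inj])
  also have "\<dots> \<le> (\<Sum>z | poly ?D z = 0. order z ?D)"
    by (rule sum_mono2) (use xT poly_roots_finite[OF det_nonzero] in auto)
  also have "\<dots> \<le> degree ?D" by (rule sum_order_le_degree[OF det_nonzero])
  also have "\<dots> \<le> (nat n - 1) * N" by (rule degree_det)
  finally have bound: "(\<Sum>t\<in>T. card (nodes t)) \<le> (nat n - 1) * N" .
  define com where "com = (\<lambda>t::real. sin (of_int n * t) = 0 \<and> sin (of_int m * t) = 0)"
  have fibre_fin: "finite (fibre t)" if "t \<in> T" for t
    using nodes_finite[of t] that by (auto simp: nodes_def T_def dest: finite_imageD)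
  have card_nodes: "card (nodes t) = card (fibre t) + (if com t then 2 else 0)" if "t \<in> T" for t
  proof -
    have "0 \<notin> fibre t" by (auto simp: fibre_def chord_solutions_def)
    then have "Some ` fibre t \<inter> {Some 0, None} = {}" by auto
    then show ?thesis using fibre_fin[OF that]
      by (auto simp: nodes_def com_def card_Un_disjoint card_image)
  qed
  have sol: "chord_solutions p = Sigma T fibre"
    by (auto simp: fibre_def T_def nodes_def chord_solutions_def)
  have card_sol: "card (chord_solutions p) = (\<Sum>t\<in>T. card (fibre t))"
    unfolding sol using finT fibre_fin by (intro card_SigmaI) auto
  have fin: "finite (chord_solutions p)"
    unfolding sol using finT fibre_fin by (intro finite_SigmaI) auto
  have arith: "A \<le> 2 * (q - gcd n m + 1)"
    if "2 * (gcd n m - 1) \<le> B" "S = A + B" "S \<le> R" "R = 2 * q" for A B S R q :: int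
    using that by presburger
  define e where "e = gcd n m"
  have e: "e > 0" "e dvd n" "e dvd m" using n by (auto simp: e_def)
  \<comment> \<open>The angles \<open>l * pi / e\<close> are common zeros of the two sines. They
    belong to \<open>T\<close> even when their fibre is empty, since \<open>0\<close> and infinity
    are nodes there.\<close>
  have "card {1..<e} \<le> card {t \<in> T. com t}"
  proof (rule card_inj_on_le)
    show "inj_on (\<lambda>l. of_int l * pi / of_int e) {1..<e}"
      using e by (auto simp: inj_on_def)
    have "sin (of_int k * (of_int l * pi / of_int e)) = 0" if "e dvd k" for k l
    proof -
      obtain r where "k = e * r" using \<open>e dvd k\<close> by auto
      then have "of_int k * (of_int l * pi / of_int e) = of_int (r * l) * pi" using e by simp
      moreover have "sin (of_int (r * l) * pi) = 0" unfolding sin_zero_iff_int2 by blast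
      ultimately show ?thesis by (simp only:)
    qed
    then have "com (of_int l * pi / of_int e)" for l using e by (simp add: com_def)
    then show "(\<lambda>l. of_int l * pi / of_int e) ` {1..<e} \<subseteq> {t \<in> T. com t}"
      using e by (auto simp: T_def nodes_def com_def field_simps)
  qed (use finT in auto)
  then have "2 * (e - 1) \<le> int (\<Sum>t\<in>T. if com t then 2 else 0)"
    using finT e by (simp add: sum.If_cases Int_def)
  moreover have "int (\<Sum>t\<in>T. card (nodes t)) = int (card (chord_solutions p) + (\<Sum>t\<in>T. if com t then 2 else 0))"
    unfolding card_sol sum.distrib[symmetric] of_nat_eq_iff by (intro sum.cong refl card_nodes)
  moreover have "int (\<Sum>t\<in>T. card (nodes t)) \<le> int ((nat n - 1) * N)"
    using bound by (simp only: of_nat_le_iff)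
  moreover have "int ((nat n - 1) * N) = 2 * ((n - 1) * (n - m))"
    using n d by (simp add: N_def of_nat_diff)
  ultimately have "int (card (chord_solutions p)) \<le> 2 * sigma_bound m n"
    unfolding sigma_bound_def e_def of_nat_add by (rule arith)
  with fin show ?thesis by simp
qed

end

subsection \<open>Chords and self-intersections\<close>

lemma laurent_coeffs_eq_0:
  fixes c :: "int \<Rightarrow> complex"
  assumes K: "finite K" and Z: "infinite Z" "0 \<notin> Z"
    and van: "\<And>z. z \<in> Z \<Longrightarrow> (\<Sum>k\<in>K. c k * z powi k) = 0" and k: "k \<in> K"
  shows "c k = 0"
proof -
  define lo where "lo = Min K"
  define N where "N = nat (Max K - lo + 1)"
  define b where "b = (\<lambda>k. if k \<in> K then c k else 0)"
  have range: "l \<in> {lo..<lo + int N}" if "l \<in> K" for l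
  proof -
    have "lo \<le> l" "l \<le> Max K" using K that by (auto simp: lo_def)
    then show ?thesis by (auto simp: N_def)
  qed
  obtain V where V: "V \<subseteq> Z" "finite V" "card V = N"
    using infinite_arbitrarily_large[OF Z(1)] by blast
  have "b (lo + int (nat (k - lo))) = 0"
  proof (rule proj_power_vanish[of "Some ` V" N "\<lambda>j. b (lo + int j)"])
    show "nat (k - lo) < N" using range[OF k] by auto
    fix w assume "w \<in> Some ` V"
    then obtain z where z: "w = Some z" "z \<in> Z" using V by auto
    then have "z \<noteq> 0" using Z by auto
    then have "(\<Sum>j<N. b (lo + int j) * z ^ j) = z powi (- lo) * (\<Sum>k\<in>K. b k * z powi k)"
      using range K by (intro sum_shift_powi) (auto simp: b_def split: if_splits)
    also have "(\<Sum>k\<in>K. b k * z powi k) = (\<Sum>k\<in>K. c k * z powi k)"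
      by (intro sum.cong) (auto simp: b_def)
    finally show "(\<Sum>j<N. b (lo + int j) * proj_power N w j) = 0"
      using van[OF z(2)] z(1) by (simp add: proj_power_def)
  qed (use V in \<open>auto simp: card_image\<close>)
  then show ?thesis using range[OF k] k by (simp add: b_def)
qed

lemma laurent_eval_chord:
  assumes "\<zeta> \<noteq> 0"
  shows "laurent_eval p (\<zeta> * cis t) - laurent_eval p (\<zeta> * cis (- t)) =
    2 * \<i> * (\<Sum>k\<in>Poly_Mapping.keys p. Poly_Mapping.lookup p k * \<zeta> powi k * of_real (sin (of_int k * t)))"
proof -
  have "Poly_Mapping.lookup p k * (\<zeta> * cis t) powi k - Poly_Mapping.lookup p k * (\<zeta> * cis (- t)) powi k =
      2 * \<i> * (Poly_Mapping.lookup p k * \<zeta> powi k * of_real (sin (of_int k * t)))" for k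
  proof -
    have "cis (of_int k * t) - cis (of_int k * - t) = 2 * \<i> * of_real (sin (of_int k * t))"
      by (simp add: complex_eq_iff)
    then have "Poly_Mapping.lookup p k * \<zeta> powi k * (cis (of_int k * t) - cis (of_int k * - t)) =
        2 * \<i> * (Poly_Mapping.lookup p k * \<zeta> powi k * of_real (sin (of_int k * t)))"
      by (simp only: mult_ac)
    then show ?thesis
      by (simp only: power_int_mult_distrib cis_power_int right_diff_distrib mult.assoc)
  qed
  then show ?thesis
    unfolding laurent_eval_def sum_subtractf[symmetric] sum_distrib_left by (intro sum.cong refl)
qed

text \<open>All the sines vanish at \<open>t\<close> exactly when the chord equation holds for every
  \<zeta>, that is, when \<open>p\<close> is invariant under rotation by \<open>2 * t\<close>. The
  nonzero exponent \<open>k0\<close> makes \<open>t / pi\<close> rational, and the denominator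
  serves as \<open>j\<close>.\<close>

lemma power_composite_iff:
  assumes k0: "k0 \<in> Poly_Mapping.keys p" "k0 \<noteq> 0"
  shows "power_composite p \<longleftrightarrow>
    (\<exists>t. 0 < t \<and> t < pi \<and> (\<forall>k\<in>Poly_Mapping.keys p. sin (of_int k * t) = 0))"
proof
  assume "power_composite p"
  then obtain q :: laurent_poly and j :: int where j: "j \<notin> {-1, 1}"
    and q: "\<And>z. z \<noteq> 0 \<Longrightarrow> laurent_eval p z = laurent_eval q (z powi j)"
    unfolding power_composite_def by auto
  \<comment> \<open>For \<open>j = 0\<close> the condition \<open>sin (j * t) = 0\<close> is void
    and any angle serves; otherwise this is the first positive zero, below \<open>pi\<close> because
    \<open>j\<close> has absolute value at least 2.\<close>
  define t where "t = (if j = 0 then pi / 2 else pi / \<bar>of_int j\<bar>)"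
  have t: "0 < t" "t < pi" and sin0: "sin (of_int j * t) = 0"
  proof -
    have "j = 0 \<or> \<bar>j\<bar> \<ge> 2" using j by auto
    then show "0 < t" "t < pi" "sin (of_int j * t) = 0"
      by (auto simp: t_def field_simps abs_if)
  qed
  have "cis (of_int j * t) = cis (of_int j * (- t))"
    using sin0 by (simp add: complex_eq_iff)
  then have pw: "(\<zeta> * cis t) powi j = (\<zeta> * cis (- t)) powi j" for \<zeta>
    by (simp add: power_int_mult_distrib cis_power_int)
  have "Poly_Mapping.lookup p k * of_real (sin (of_int k * t)) = 0" if "k \<in> Poly_Mapping.keys p" for k
  proof (rule laurent_coeffs_eq_0[where Z = "sphere 0 1"])
    show "infinite (sphere (0::complex) 1)"
    proof
      assume "finite (sphere (0::complex) 1)"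
      moreover have "cis ` {0<..<pi} \<subseteq> sphere 0 1" by auto
      ultimately have "finite (cis ` {0<..<pi})" using finite_subset by blast
      moreover have "inj_on cis {0<..<pi}"
        by (intro inj_onI) (auto simp: complex_eq_iff intro: cos_inj_pi)
      ultimately have "finite {0<..<pi}" by (rule finite_imageD)
      then show False using infinite_Ioo[of 0 pi] by simp
    qed
    fix z :: complex assume "z \<in> sphere 0 1"
    then have z: "z \<noteq> 0" by auto
    then have "laurent_eval p (z * cis t) = laurent_eval p (z * cis (- t))"
      using pw[of z] by (simp add: q)
    then show "(\<Sum>k\<in>Poly_Mapping.keys p. Poly_Mapping.lookup p k * of_real (sin (of_int k * t)) * z powi k) = 0"
      using laurent_eval_chord[OF z, of p t] by (simp add: mult_ac)
  qed (use that in auto)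
  then show "\<exists>t. 0 < t \<and> t < pi \<and> (\<forall>k\<in>Poly_Mapping.keys p. sin (of_int k * t) = 0)"
    using t by (intro exI[of _ t]) (auto simp: in_keys_iff)
next
  assume "\<exists>t. 0 < t \<and> t < pi \<and> (\<forall>k\<in>Poly_Mapping.keys p. sin (of_int k * t) = 0)"
  then obtain t where t: "0 < t" "t < pi" and van: "\<And>k. k \<in> Poly_Mapping.keys p \<Longrightarrow> sin (of_int k * t) = 0"
    by auto
  have mult: "\<exists>i::int. of_int k * (t / pi) = of_int i" if "k \<in> Poly_Mapping.keys p" for k
  proof -
    from van[OF that] obtain i :: int where "of_int k * t = of_int i * pi"
      by (auto simp: sin_zero_iff_int2)
    then show ?thesis by (intro exI[of _ i]) simp
  qed
  obtain i0 :: int where "of_int k0 * (t / pi) = of_int i0" using mult[OF k0(1)] by auto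
  then have "t / pi = of_int i0 / of_int k0" using k0(2) by (simp add: field_simps)
  then have "t / pi \<in> \<rat>" by (metis Rats_divide Rats_of_int)
  \<comment> \<open>In lowest terms, integrality of \<open>k * a / b\<close> forces \<open>b\<close>
    to divide every exponent \<open>k\<close>, and \<open>0 < t < pi\<close> forces \<open>b\<close>
    to be at least 2.\<close>
  then obtain a b :: int where b: "b > 0" and cop: "coprime a b" and ab: "t / pi = of_int a / of_int b"
    by (rule Rats_cases')
  have "0 < t / pi" "t / pi < 1" using t by auto
  then have "0 < a" "a < b" unfolding ab using b by (auto simp: zero_less_divide_iff)
  then have b2: "b \<ge> 2" by simp
  have dvd: "b dvd k" if "k \<in> Poly_Mapping.keys p" for k
  proof -
    from mult[OF that] obtain i :: int where "of_int k * (t / pi) = of_int i" by auto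
    then have "real_of_int (k * a) = of_int (i * b)" unfolding ab using b by (simp add: field_simps)
    then have "b dvd k * a" by (metis dvd_triv_right of_int_eq_iff)
    then show ?thesis using cop by (metis coprime_commute coprime_dvd_mult_left_iff)
  qed
  define q where "q = Poly_Mapping.map_key (\<lambda>k. b * k) p"
  have inj: "inj (\<lambda>k. b * k)" using b by (auto simp: inj_def)
  have lookup_q: "Poly_Mapping.lookup q k = Poly_Mapping.lookup p (b * k)" for k
    using map_key.rep_eq[OF inj, of p] by (simp add: q_def)
  have "laurent_eval p z = laurent_eval q (z powi b)" for z
    unfolding laurent_eval_def
  proof (rule sum.reindex_bij_witness[of _ "\<lambda>k. b * k" "\<lambda>k. k div b"])
    fix k assume k: "k \<in> Poly_Mapping.keys p"
    then show "k div b \<in> Poly_Mapping.keys q" "b * (k div b) = k"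
      "Poly_Mapping.lookup q (k div b) * (z powi b) powi (k div b) = Poly_Mapping.lookup p k * z powi k"
      using dvd[OF k] by (auto simp: in_keys_iff lookup_q simp flip: power_int_mult)
  next
    fix k assume "k \<in> Poly_Mapping.keys q"
    then show "b * k div b = k" "b * k \<in> Poly_Mapping.keys p"
      using b by (auto simp: in_keys_iff lookup_q)
  qed
  then show "power_composite p"
    unfolding power_composite_def using b2 by (intro exI[of _ q] exI[of _ b]) auto
qed

section \<open>Two-point subsets of the circle in the coordinates
  \<open>(t, \<zeta>)\<close>\<close>

definition chord :: "real \<times> complex \<Rightarrow> complex set" where
  "chord q = {snd q * cis (fst q), snd q * cis (- fst q)}"

lemma chord_solutions_iff:
  "(t, \<zeta>) \<in> chord_solutions p \<longleftrightarrow> 0 < t \<and> t < pi \<and> \<zeta> \<in> sphere 0 1 \<and>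
     laurent_eval p (\<zeta> * cis t) = laurent_eval p (\<zeta> * cis (- t))"
proof (cases "\<zeta> \<in> sphere 0 1")
  case True
  then have "\<zeta> \<noteq> 0" by auto
  from laurent_eval_chord[OF this, of p t] show ?thesis
    by (auto simp: chord_solutions_def)
qed (auto simp: chord_solutions_def)

lemma cis_neq_cis_uminus: "0 < t \<Longrightarrow> t < pi \<Longrightarrow> cis t \<noteq> cis (- t)"
  using sin_gt_zero[of t] by (auto simp: complex_eq_iff)

text \<open>Here \<zeta> is the midpoint of an arc from \<open>w\<close> to \<open>z\<close>, and
  \<open>t\<close> is half the length of that arc.\<close>

lemma unit_pair_eq_chord:
  assumes z: "z \<in> sphere 0 1" and w: "w \<in> sphere (0::complex) 1" and "z \<noteq> w"
  obtains t \<zeta> where "0 < t" "t < pi" "\<zeta> \<in> sphere 0 1" "z = \<zeta> * cis t" "w = \<zeta> * cis (- t)"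
proof -
  have w0: "w \<noteq> 0" using w by auto
  have "cmod (z / w) = 1" using z w by (simp add: norm_divide)
  then obtain \<theta> where \<theta>: "0 \<le> \<theta>" "\<theta> < 2 * pi" "z / w = cis \<theta>"
    using complex_unimodular_polar[of "z / w"] by (metis cis_conv_exp cis.code)
  have "\<theta> \<noteq> 0"
  proof
    assume "\<theta> = 0"
    then show False using \<theta>(3) w0 \<open>z \<noteq> w\<close> by simp
  qed
  moreover have "z = (w * cis (\<theta> / 2)) * cis (\<theta> / 2)"
    using \<theta>(3) w0 by (simp add: mult.assoc cis_mult field_simps)
  moreover have "w = (w * cis (\<theta> / 2)) * cis (- (\<theta> / 2))"
    by (simp add: mult.assoc cis_mult)
  moreover have "w * cis (\<theta> / 2) \<in> sphere 0 1" using w by (simp add: norm_mult)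
  ultimately show ?thesis using that[of "\<theta> / 2" "w * cis (\<theta> / 2)"] \<theta> by auto
qed

text \<open>The product \<open>\<zeta>^2\<close> of the two points determines \<zeta> up to sign,
  and their sum \<open>2 * \<zeta> * cos t\<close> then determines \<open>t\<close>. The second pair
  describes the complementary arc.\<close>

lemma chord_eq_iff:
  assumes t: "0 < t" "t < pi" and t': "0 < t'" "t' < pi" and z: "\<zeta> \<noteq> 0"
  shows "chord (t', \<zeta>') = chord (t, \<zeta>) \<longleftrightarrow> (t', \<zeta>') \<in> {(t, \<zeta>), (pi - t, - \<zeta>)}"
proof
  have sum: "\<xi> * cis s + \<xi> * cis (- s) = 2 * \<xi> * of_real (cos s)"
    and prod: "(\<xi> * cis s) * (\<xi> * cis (- s)) = \<xi> ^ 2" for \<xi> s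
    by (auto simp: complex_eq_iff algebra_simps power2_eq_square cis_mult)
  assume "chord (t', \<zeta>') = chord (t, \<zeta>)"
  then have "(\<zeta>' * cis t' = \<zeta> * cis t \<and> \<zeta>' * cis (- t') = \<zeta> * cis (- t)) \<or>
             (\<zeta>' * cis t' = \<zeta> * cis (- t) \<and> \<zeta>' * cis (- t') = \<zeta> * cis t)"
    by (auto simp: chord_def doubleton_eq_iff)
  then have "2 * \<zeta>' * of_real (cos t') = 2 * \<zeta> * of_real (cos t)" and sq: "\<zeta>' ^ 2 = \<zeta> ^ 2"
    unfolding sum[symmetric] prod[of \<zeta>' t', symmetric] prod[of \<zeta> t, symmetric] by auto
  then have lin: "\<zeta>' * of_real (cos t') = \<zeta> * of_real (cos t)" by simp
  from sq consider "\<zeta>' = \<zeta>" | "\<zeta>' = - \<zeta>" by (auto simp: power2_eq_iff)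
  then show "(t', \<zeta>') \<in> {(t, \<zeta>), (pi - t, - \<zeta>)}"
  proof cases
    case 1
    then have "cos t' = cos t" using lin z by simp
    then have "t' = t" using cos_inj_pi[of t' t] t t' by simp
    then show ?thesis using 1 by simp
  next
    case 2
    then have "\<zeta> * of_real (- cos t') = \<zeta> * of_real (cos t)" using lin by simp
    then have "of_real (- cos t') = (of_real (cos t) :: complex)" using z by (metis mult_left_cancel)
    then have "cos t' = cos (pi - t)" by (simp only: of_real_eq_iff) simp
    then have "t' = pi - t" using cos_inj_pi[of t' "pi - t"] t t' by simp
    then show ?thesis using 2 by simp
  qed
next
  have "cis (pi - t) = - cis (- t)" "cis (- (pi - t)) = - cis t"
    by (auto simp: complex_eq_iff)
  then have "chord (pi - t, - \<zeta>) = chord (t, \<zeta>)" by (auto simp: chord_def)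
  then show "(t', \<zeta>') \<in> {(t, \<zeta>), (pi - t, - \<zeta>)} \<Longrightarrow> chord (t', \<zeta>') = chord (t, \<zeta>)" by auto
qed

lemma chord_image: "chord ` chord_solutions p = self_intersections p"
proof safe
  fix t \<zeta> assume q: "(t, \<zeta>) \<in> chord_solutions p"
  then have "\<zeta> \<noteq> 0" by (auto simp: chord_solutions_iff)
  then have "\<zeta> * cis t \<noteq> \<zeta> * cis (- t)"
    using cis_neq_cis_uminus[of t] q by (auto simp: chord_solutions_iff)
  then show "chord (t, \<zeta>) \<in> self_intersections p"
    using q unfolding self_intersections_def chord_solutions_iff chord_def fst_conv snd_conv
    by (intro CollectI exI[of _ "\<zeta> * cis t"] exI[of _ "\<zeta> * cis (- t)"]) (simp add: norm_mult)
next
  fix e assume "e \<in> self_intersections p"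
  then obtain z w where zw: "e = {z, w}" "z \<in> sphere 0 1" "w \<in> sphere 0 1" "z \<noteq> w" "laurent_eval p z = laurent_eval p w"
    unfolding self_intersections_def by blast
  obtain t \<zeta> where t: "0 < t" "t < pi" "\<zeta> \<in> sphere 0 1" "z = \<zeta> * cis t" "w = \<zeta> * cis (- t)"
    using unit_pair_eq_chord[OF zw(2-4)] .
  then have "(t, \<zeta>) \<in> chord_solutions p" "e = chord (t, \<zeta>)"
    using zw by (auto simp: chord_solutions_iff chord_def)
  then show "e \<in> chord ` chord_solutions p" by blast
qed

text \<open>Each self-intersection is counted twice, once for each of the two arcs between its
  points.\<close>

lemma card_chord_solutions:
  assumes fin: "finite (chord_solutions p)"
  shows "finite (self_intersections p)" "card (chord_solutions p) = 2 * card (self_intersections p)"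
proof -
  show finS: "finite (self_intersections p)"
    unfolding chord_image[symmetric] using fin by simp
  have "card {q \<in> chord_solutions p. chord q = e} = 2" if "e \<in> self_intersections p" for e
  proof -
    from that obtain t \<zeta> where q: "(t, \<zeta>) \<in> chord_solutions p" "e = chord (t, \<zeta>)"
      unfolding chord_image[symmetric] by auto
    then have t: "0 < t" "t < pi" and z: "\<zeta> \<noteq> 0" by (auto simp: chord_solutions_iff)
    have "cis (pi - t) = - cis (- t)" "cis (- (pi - t)) = - cis t"
      by (auto simp: complex_eq_iff)
    then have "(pi - t, - \<zeta>) \<in> chord_solutions p"
      using q(1) by (auto simp: chord_solutions_iff)
    moreover have "chord (pi - t, - \<zeta>) = e"
      unfolding q(2) by (subst chord_eq_iff[OF t _ _ z]) (use t in auto)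
    moreover have "r \<in> {(t, \<zeta>), (pi - t, - \<zeta>)}" if "r \<in> chord_solutions p" "chord r = e" for r
    proof -
      obtain t' \<zeta>' where r: "r = (t', \<zeta>')" by (cases r)
      then have "0 < t'" "t' < pi" using that(1) by (auto simp: chord_solutions_iff)
      from chord_eq_iff[OF t this z] show ?thesis using that(2) q(2) r by blast
    qed
    ultimately have "{q \<in> chord_solutions p. chord q = e} = {(t, \<zeta>), (pi - t, - \<zeta>)}"
      using q by blast
    then show ?thesis using z by auto
  qed
  then have "(\<Sum>e\<in>self_intersections p. card {q \<in> chord_solutions p. chord q = e}) = 2 * card (self_intersections p)"
    by simp
  moreover have "(\<Sum>e\<in>self_intersections p. card {q \<in> chord_solutions p. chord q = e}) = card (chord_solutions p)"
    using sum.group[OF fin finS, of chord "\<lambda>_. 1 :: nat"] chord_image by simp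
  ultimately show "card (chord_solutions p) = 2 * card (self_intersections p)" by simp
qed

lemma chord_solutions_bound:
  assumes mn: "n \<ge> \<bar>m\<bar>" "\<bar>m\<bar> \<ge> 1" and p: "p \<in> laurent_polys m n"
    and npc: "\<not> power_composite p" and unbal: "\<not> balanced_ends m n p"
  shows "finite (chord_solutions p) \<and> int (card (chord_solutions p)) \<le> 2 * sigma_bound m n"
proof -
  have keys: "Poly_Mapping.keys p \<subseteq> {m..n}" "n \<in> Poly_Mapping.keys p" "n \<noteq> 0"
    using p mn by (auto simp: laurent_polys_def in_keys_iff)
  have nonvan: "\<exists>k\<in>Poly_Mapping.keys p. sin (of_int k * t) \<noteq> 0" if "0 < t" "t < pi" for t
    using npc power_composite_iff[OF keys(2,3)] that by blast
  show ?thesis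
  proof (cases "m = n")
    case False
    interpret chord_system m n p
      using mn p nonvan unbal False by unfold_locales auto
    show ?thesis by (rule card_chord_solutions_le)
  next
    case True
    have k: "Poly_Mapping.keys p = {n}" using keys True by auto
    \<comment> \<open>For a monomial with larger exponent, \<open>t = pi / n\<close> would violate
      \<open>nonvan\<close>. With \<open>n = 1\<close> there are no solutions, and the bound is
      0.\<close>
    have "n = 1"
    proof (rule ccontr)
      assume "n \<noteq> 1"
      then have "n \<ge> 2" using mn by simp
      then have "0 < pi / of_int n" "pi / of_int n < pi" by (auto simp: field_simps)
      from nonvan[OF this] k \<open>n \<ge> 2\<close> show False by auto
    qed
    have "chord_solutions p = {}"
    proof -
      have "sin t \<noteq> 0" if "0 < t" "t < pi" for t :: real
        using sin_gt_zero[OF that] by simp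
      then show ?thesis
        using k \<open>n = 1\<close> by (auto simp: chord_solutions_def in_keys_iff[symmetric])
    qed
    then show ?thesis using \<open>n = 1\<close> True by (simp add: sigma_bound_def)
  qed
qed

lemma self_intersections_upper_bound:
  assumes "n \<ge> \<bar>m\<bar>" "\<bar>m\<bar> \<ge> 1" "p \<in> laurent_polys m n" "\<not> power_composite p" "\<not> balanced_ends m n p"
  shows "finite (self_intersections p) \<and> int (card (self_intersections p)) \<le> sigma_bound m n"
  using chord_solutions_bound[OF assms] card_chord_solutions[of p] by auto

subsection \<open>Zeros of trinomials on the circle\<close>

text \<open>Brouwer's theorem gives a fixed point of \<open>(x - f x y, y - g x y)\<close> clamped
  to the rectangle. Were clamping active in a coordinate, the point would lie on the matching side,
  where the sign of \<open>f\<close> or \<open>g\<close> excludes it.\<close>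

lemma poincare_miranda_2d:
  fixes f g :: "real \<Rightarrow> real \<Rightarrow> real"
  assumes ab: "a \<le> b" "c \<le> d"
    and f: "continuous_on ({a..b} \<times> {c..d}) (\<lambda>(x,y). f x y)"
    and g: "continuous_on ({a..b} \<times> {c..d}) (\<lambda>(x,y). g x y)"
    and fa: "\<And>y. y \<in> {c..d} \<Longrightarrow> f a y < 0" and fb: "\<And>y. y \<in> {c..d} \<Longrightarrow> f b y > 0"
    and gc: "\<And>x. x \<in> {a..b} \<Longrightarrow> g x c < 0" and gd: "\<And>x. x \<in> {a..b} \<Longrightarrow> g x d > 0"
  obtains x y where "x \<in> {a..b}" "y \<in> {c..d}" "f x y = 0" "g x y = 0"
proof -
  define S where "S = {a..b} \<times> {c..d}"
  define h where "h = (\<lambda>p. (max a (min b (fst p - (\<lambda>(x,y). f x y) p)), max c (min d (snd p - (\<lambda>(x,y). g x y) p))))"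
  have "continuous_on S h"
    unfolding h_def S_def using f g
    by (intro continuous_intros) auto
  moreover have "h \<in> S \<rightarrow> S" using ab by (auto simp: h_def S_def)
  moreover have "compact S" "convex S" "S \<noteq> {}"
    using ab by (auto simp: S_def compact_Times convex_Times)
  ultimately obtain p where p: "p \<in> S" "h p = p"
    using brouwer[of S h] by blast
  obtain x y where xy: "p = (x, y)" by fastforce
  have x: "x \<in> {a..b}" and y: "y \<in> {c..d}" using p(1) xy by (auto simp: S_def)
  have hx: "max a (min b (x - f x y)) = x" and hy: "max c (min d (y - g x y)) = y"
    using p(2) xy by (auto simp: h_def)
  have "f x y = 0" using hx x fa[OF y] fb[OF y] by (auto simp: max_def min_def split: if_splits)
  moreover have "g x y = 0" using hy y gc[OF x] gd[OF x] by (auto simp: max_def min_def split: if_splits)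
  ultimately show ?thesis using that x y by blast
qed


lemma cis_eq_cisD:
  assumes "cis a = cis b"
  shows "\<exists>k::int. a - b = of_int k * (2 * pi)"
proof -
  have "cis (a - b) = 1" using assms by (simp add: cis_divide [symmetric])
  then have "cos (a - b) = 1" by (metis cis.sel(1) one_complex.sel(1))
  then show ?thesis by (simp add: cos_one_2pi_int mult.commute mult.left_commute)
qed

text \<open>
  Near the angles where \<open>A u\<^sup>M\<close> and \<open>B\<close> have opposite directions, the perturbation \<open>C u\<^sup>k\<close> is too
  small to influence the sign of the imaginary part on the lateral sides of a rectangle in \<open>(t, arg u)\<close>,
  while the change of \<open>\<bar>A\<bar>\<close> from below to above \<open>\<bar>B\<bar>\<close> flips the sign of the real part.
\<close>
lemma trinomial_zeros_on_circle:
  fixes A B C :: "real \<Rightarrow> real" and k :: int and M :: nat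
  assumes M: "M \<ge> 1"
    and cA: "continuous_on {0..1} A" and cB: "continuous_on {0..1} B" and cC: "continuous_on {0..1} C"
    and dom: "\<And>t. t \<in> {0..1} \<Longrightarrow> 2 * \<bar>C t\<bar> < \<bar>A t\<bar>"
    and start: "\<bar>A 0\<bar> + \<bar>C 0\<bar> < \<bar>B 0\<bar>" and finish: "2 * (\<bar>B 1\<bar> + \<bar>C 1\<bar>) < \<bar>A 1\<bar>"
  obtains U :: "complex set" where "finite U" "card U = M" "U \<subseteq> sphere 0 1"
    "\<And>u. u \<in> U \<Longrightarrow> \<exists>t\<in>{0..1}. of_real (A t) * u ^ M + of_real (B t) + of_real (C t) * u powi k = 0"
proof -
  have Anz: "A t \<noteq> 0" if "t \<in> {0..1}" for t
    using dom[OF that] by auto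
  \<comment> \<open>\<open>A\<close> has no zero on the interval, so by connectedness it keeps its
    sign.\<close>
  have Asgn: "A t = sgn (A 0) * \<bar>A t\<bar>" if t: "t \<in> {0..1}" for t
  proof (rule ccontr)
    assume ne: "A t \<noteq> sgn (A 0) * \<bar>A t\<bar>"
    have "connected (A ` {0..1})"
      using cA by (rule connected_continuous_image) simp
    moreover have "A 0 \<in> A ` {0..1}" "A t \<in> A ` {0..1}" using t by auto
    moreover have "A 0 \<le> 0 \<and> 0 \<le> A t \<or> A t \<le> 0 \<and> 0 \<le> A 0"
      using ne Anz[of 0] by (auto simp: sgn_if abs_if split: if_splits)
    ultimately have "0 \<in> A ` {0..1}"
      unfolding connected_iff_interval by blast
    then show False using Anz by auto
  qed
  \<comment> \<open>The required argument of \<open>u ^ M\<close>: it gives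
    \<open>A 0 * u ^ M\<close> the sign opposite to \<open>B 0\<close>.\<close>
  define c where "c = (if A 0 * B 0 < 0 then 0 else pi)"
  define \<sigma> where "\<sigma> = cos c"
  \<comment> \<open>A sign normalising the equation: after multiplication by \<rho>, the first
    coefficient is \<bar>A t\<bar> and \<open>B 0\<close> becomes negative.\<close>
  define \<rho> where "\<rho> = sgn (A 0) * \<sigma>"
  have \<sigma>: "\<sigma> = 1 \<or> \<sigma> = -1" "sin c = 0" by (auto simp: \<sigma>_def c_def)
  have A0: "A 0 \<noteq> 0" and B0: "B 0 \<noteq> 0" using Anz[of 0] start by auto
  have \<rho>: "\<bar>\<rho>\<bar> = 1" using \<sigma> A0 by (auto simp: \<rho>_def abs_mult)
  have \<rho>A: "\<rho> * \<sigma> * A t = \<bar>A t\<bar>" if t: "t \<in> {0..1}" for t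
    using Asgn[OF t] Anz[of 0] \<sigma> by (auto simp: \<rho>_def sgn_if split: if_splits)
  have \<rho>B: "\<rho> * B 0 = - \<bar>B 0\<bar>"
    using A0 B0 by (auto simp: \<rho>_def \<sigma>_def c_def sgn_if mult_less_0_iff split: if_splits)
  \<comment> \<open>Over a window of half-width \<open>w\<close> the angle \<open>M * y\<close>
    stays within \<open>pi / 3\<close> of 0, so its cosine is at least 1/2, and at the ends its sine
    is at least 1/2 in absolute value.\<close>
  define w where "w = pi / (3 * real M)"
  have w: "w > 0" "real M * w = pi / 3" using M by (auto simp: w_def)
  \<comment> \<open>The window centres: the \<open>M\<close> solutions of \<open>M * s = c\<close>
    modulo \<open>2 * pi\<close>.\<close>
  define s where "s = (\<lambda>j::nat. (2 * pi * real j + c) / real M)"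
  have Ms: "cos (real M * (s j + y)) = \<sigma> * cos (real M * y)"
           "sin (real M * (s j + y)) = \<sigma> * sin (real M * y)" for j y
  proof -
    have *: "real M * (s j + y) = (c + real M * y) + 2 * pi * real j" using M by (simp add: s_def field_simps)
    have "cos (2 * pi * real j) = 1" "sin (2 * pi * real j) = 0"
      using cos_2npi[of j] sin_2npi[of j] by (simp_all add: mult.commute mult.left_commute)
    then show "cos (real M * (s j + y)) = \<sigma> * cos (real M * y)"
      "sin (real M * (s j + y)) = \<sigma> * sin (real M * y)"
      unfolding * cos_add sin_add using \<sigma>(2) by (simp_all add: \<sigma>_def)
  qed
  have ex: "\<exists>t y. t \<in> {0..1} \<and> \<bar>y\<bar> \<le> w \<and>
      of_real (A t) * cis (s j + y) ^ M + of_real (B t) + of_real (C t) * cis (s j + y) powi k = 0" for j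
  proof -
    \<comment> \<open>\<open>f\<close> and \<open>g\<close> are \<rho> times the real and imaginary
      parts of the trinomial at \<open>cis (s j + y)\<close>.\<close>
    define f where "f = (\<lambda>t y. \<rho> * (A t * (\<sigma> * cos (real M * y)) + B t + C t * cos (of_int k * (s j + y))))"
    define g where "g = (\<lambda>t y. \<rho> * (A t * (\<sigma> * sin (real M * y)) + C t * sin (of_int k * (s j + y))))"
    have *: "continuous_on ({0..1} \<times> {-w..w}) (\<lambda>q. h (fst q))" if "continuous_on {0..1} h" for h :: "real \<Rightarrow> real"
      by (rule continuous_on_compose2[OF that]) (auto intro!: continuous_intros)
    have f': "f t y = \<bar>A t\<bar> * cos (real M * y) + \<rho> * B t + \<rho> * (C t * cos (of_int k * (s j + y)))"
      if "t \<in> {0..1}" for t y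
      using \<rho>A[OF that] by (simp add: f_def algebra_simps)
    have g': "g t y = \<bar>A t\<bar> * sin (real M * y) + \<rho> * (C t * sin (of_int k * (s j + y)))"
      if "t \<in> {0..1}" for t y
      using \<rho>A[OF that] by (simp add: g_def algebra_simps)
    have C1: "\<bar>\<rho> * (C t * cos x)\<bar> \<le> \<bar>C t\<bar>" "\<bar>\<rho> * (C t * sin x)\<bar> \<le> \<bar>C t\<bar>" for t x
      using \<rho> by (auto simp: abs_mult mult_left_le)
    have cosge: "cos (real M * y) \<ge> 1 / 2" if "y \<in> {-w..w}" for y
    proof -
      have "\<bar>real M * y\<bar> \<le> pi / 3"
        using that w M by (metis abs_le_iff abs_mult abs_of_nat atLeastAtMost_iff minus_le_iff mult_left_mono of_nat_0_le_iff)
      then have "cos (pi / 3) \<le> cos \<bar>real M * y\<bar>" by (intro cos_monotone_0_pi_le) auto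
      then show ?thesis by (simp add: cos_60)
    qed
    have sin60: "sin (pi / 3) \<ge> 1 / 2"
      using real_le_rsqrt[of 1 3] by (simp add: sin_60)
    obtain t y where ty: "t \<in> {0..1}" "y \<in> {-w..w}" "f t y = 0" "g t y = 0"
    proof (rule poincare_miranda_2d[of 0 1 "-w" w f g])
      show "continuous_on ({0..1} \<times> {- w..w}) (\<lambda>(t, y). f t y)"
        unfolding f_def split_def by (intro continuous_intros *[OF cA] *[OF cB] *[OF cC])
      show "continuous_on ({0..1} \<times> {- w..w}) (\<lambda>(t, y). g t y)"
        unfolding g_def split_def by (intro continuous_intros *[OF cA] *[OF cB] *[OF cC])
      show "f 0 y < 0" if "y \<in> {-w..w}" for y
      proof -
        have "\<bar>A 0\<bar> * cos (real M * y) \<le> \<bar>A 0\<bar>" by (simp add: mult_left_le)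
        then show ?thesis using start \<rho>B f'[of 0 y] C1(1)[of 0 "of_int k * (s j + y)"] by (simp; linarith)
      qed
      show "f 1 y > 0" if "y \<in> {-w..w}" for y
      proof -
        have "\<bar>A 1\<bar> * cos (real M * y) \<ge> \<bar>A 1\<bar> * (1 / 2)" using cosge[OF that] by (intro mult_left_mono) auto
        moreover have "\<bar>\<rho> * B 1\<bar> = \<bar>B 1\<bar>" using \<rho> by (simp add: abs_mult)
        ultimately show ?thesis using finish f'[of 1 y] C1(1)[of 1 "of_int k * (s j + y)"]
          by (simp; linarith)
      qed
      have sinA: "\<bar>A t\<bar> * sin (pi / 3) > \<bar>C t\<bar>" if "t \<in> {0..1}" for t
        using dom[OF that] mult_left_mono[OF sin60, of "\<bar>A t\<bar>"] by auto
      show "g t (-w) < 0" if "t \<in> {0..1}" for t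
        using g'[OF that, of "-w"] sinA[OF that] C1(2)[of t "of_int k * (s j + - w)"] w by (simp; linarith)
      show "g t w > 0" if "t \<in> {0..1}" for t
        using g'[OF that, of w] sinA[OF that] C1(2)[of t "of_int k * (s j + w)"] w by (simp; linarith)
    qed (use w in auto)
    have "\<rho> \<noteq> 0" using \<rho> by auto
    then have "A t * (\<sigma> * cos (real M * y)) + B t + C t * cos (of_int k * (s j + y)) = 0"
      "A t * (\<sigma> * sin (real M * y)) + C t * sin (of_int k * (s j + y)) = 0"
      using ty(3,4) by (auto simp: f_def g_def)
    then have "of_real (A t) * cis (s j + y) ^ M + of_real (B t) + of_real (C t) * cis (s j + y) powi k = 0"
      by (simp add: Complex.DeMoivre cis_power_int complex_eq_iff Ms)
    then show ?thesis using ty by (intro exI[of _ t] exI[of _ y]) auto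
  qed
  then obtain T Y where TY: "\<And>j. T j \<in> {0..1} \<and> \<bar>Y j\<bar> \<le> w \<and>
      of_real (A (T j)) * cis (s j + Y j) ^ M + of_real (B (T j)) + of_real (C (T j)) * cis (s j + Y j) powi k = 0"
    by metis
  have inj: "cis (s i + Y i) \<noteq> cis (s j + Y j)" if "i < j" "j < M" for i j
  proof
    assume "cis (s i + Y i) = cis (s j + Y j)"
    from cis_eq_cisD[OF this[symmetric]] obtain r :: int where r: "(s j + Y j) - (s i + Y i) = of_int r * (2 * pi)" ..
    \<comment> \<open>Centres are at least \<open>6 * w\<close> apart, also across the cut at
      \<open>2 * pi\<close>, while each point strays from its centre by at most
      \<open>w\<close>.\<close>
    have sd: "s j - s i = 2 * pi * real (j - i) / real M"
      using that by (simp add: s_def field_simps of_nat_diff)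
    have "2 * pi / real M \<le> s j - s i"
      unfolding sd using that by (intro divide_right_mono) auto
    moreover have "s j - s i \<le> 2 * pi * (real M - 1) / real M"
      unfolding sd using that by (intro divide_right_mono mult_left_mono) auto
    moreover have "2 * pi * (real M - 1) / real M = 2 * pi - 2 * pi / real M" using M by (simp add: field_simps)
    moreover have "\<bar>Y i\<bar> \<le> w" "\<bar>Y j\<bar> \<le> w" using TY by auto
    moreover have "2 * pi / real M = 6 * w" by (simp add: w_def)
    ultimately have "0 < (s j + Y j) - (s i + Y i)" "(s j + Y j) - (s i + Y i) < 2 * pi"
      using w(1) by linarith+
    then have "0 < real_of_int r * (2 * pi)" "real_of_int r * (2 * pi) < 1 * (2 * pi)"
      unfolding r by simp_all
    then have "0 < real_of_int r" "real_of_int r < 1"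
      by (simp_all add: zero_less_mult_iff mult_less_cancel_right)
    then have "0 < r" "r < 1" by simp_all
    then show False by simp
  qed
  define U where "U = (\<lambda>j. cis (s j + Y j)) ` {..<M}"
  have "inj_on (\<lambda>j. cis (s j + Y j)) {..<M}"
    by (intro linorder_inj_onI') (use inj in auto)
  then have card: "card U = M" by (simp add: U_def card_image)
  have U: "finite U" "U \<subseteq> sphere 0 1" by (auto simp: U_def)
  have "\<exists>t\<in>{0..1}. of_real (A t) * u ^ M + of_real (B t) + of_real (C t) * u powi k = 0" if "u \<in> U" for u
    using that TY unfolding U_def by blast
  then show ?thesis by (rule that[OF U(1) card U(2)])
qed

subsection \<open>Sharpness\<close>

lemma exists_neg_right_of_0:
  fixes f :: "real \<Rightarrow> real"
  assumes "isCont f 0" "f 0 < 0" "\<delta> > 0"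
  obtains \<tau> where "0 < \<tau>" "\<tau> < \<delta>" "f \<tau> < 0"
proof -
  have "(f \<longlongrightarrow> f 0) (at 0)" using assms(1) by (simp add: isCont_def)
  then have "\<forall>\<^sub>F x in at 0. f x < 0" by (rule order_tendstoD) (use assms in auto)
  then obtain d where d: "d > 0" "\<And>x. x \<noteq> 0 \<Longrightarrow> dist x 0 < d \<Longrightarrow> f x < 0"
    unfolding eventually_at by auto
  define \<tau> where "\<tau> = min d \<delta> / 2"
  have "0 < \<tau>" "\<tau> < \<delta>" "\<tau> < d" using d(1) assms(3) by (auto simp: \<tau>_def min_def)
  then show ?thesis using that[of \<tau>] d(2)[of \<tau>] by auto
qed

lemma abs_sin_add_int_pi: "\<bar>sin (x + of_int l * pi)\<bar> = \<bar>sin x\<bar>"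
proof -
  have "sin (of_int l * pi) = 0" by (auto simp: sin_zero_iff_int2)
  moreover from this have "\<bar>cos (of_int l * pi)\<bar> = 1"
    using sin_cos_squared_add[of "of_int l * pi"] by (auto simp: power2_eq_1_iff)
  ultimately show ?thesis by (simp add: sin_add abs_mult)
qed

lemma abs_sin_int_mult_le:
  assumes "\<bar>m\<bar> \<le> n" "0 \<le> \<tau>" "of_int n * \<tau> \<le> pi / 2"
  shows "\<bar>sin (of_int m * \<tau>)\<bar> \<le> sin (of_int n * \<tau>)"
proof -
  have le: "0 \<le> of_int \<bar>m\<bar> * \<tau>" "of_int \<bar>m\<bar> * \<tau> \<le> of_int n * \<tau>"
    using assms(1,2) by (auto intro: mult_right_mono simp del: of_int_abs)
  have "sin (of_int \<bar>m\<bar> * \<tau>) \<le> sin (of_int n * \<tau>)"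
    by (rule sin_monotone_2pi_le) (use le assms(3) in auto)
  moreover have "sin (of_int \<bar>m\<bar> * \<tau>) \<ge> 0"
    by (rule sin_ge_zero) (use le assms(3) in auto)
  moreover have "\<bar>sin (of_int m * \<tau>)\<bar> = \<bar>sin (of_int \<bar>m\<bar> * \<tau>)\<bar>"
    by (cases "m \<ge> 0") auto
  ultimately show ?thesis by simp
qed

section \<open>Zeros of the perturbed binomial near the zeros of \<open>sin (n * t)\<close>\<close>

locale extremal =
  fixes m n :: int
  assumes mn: "n \<ge> \<bar>m\<bar>" "\<bar>m\<bar> \<ge> 1" and neq: "n \<noteq> m"
begin

definition "M = nat (n - m)"

lemma n: "n > 0" and M: "int M = n - m" "M \<ge> 1"
  using mn neq by (auto simp: M_def)

text \<open>This is the chord expression of \<open>P \<epsilon>\<close> with the factor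
  \<open>u powi m\<close> removed.\<close>

definition trinomial :: "real \<Rightarrow> real \<Rightarrow> complex \<Rightarrow> complex" where
  "trinomial \<epsilon> t u = of_real (sin (of_int n * t)) * u ^ M + of_real (sin (of_int m * t) / 8)
     + of_real (\<epsilon> * sin (of_int (m + 1) * t)) * u"

definition angle :: "int \<Rightarrow> real" where "angle l = of_int l * pi / of_int n"

text \<open>A third of the spacing of the angles: the windows around different angles are disjoint,
  and \<open>sin (n * \<delta>) = sin (pi / 3)\<close> exceeds 1/2.\<close>

definition \<delta> :: real where "\<delta> = pi / (3 * of_int n)"

lemma \<delta>: "\<delta> > 0" "of_int n * \<delta> = pi / 3"
  using n by (auto simp: \<delta>_def)

lemma two_mult_less: "x < 1 / 4 \<Longrightarrow> 1 / 2 < y \<Longrightarrow> 2 * x < (y :: real)"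
  by simp

lemma sin_pi_3_gt: "sin (pi / 3) > 1 / 2"
  using real_less_rsqrt[of 1 3] by (simp add: sin_60)

lemma abs_sin_n:
  assumes "s \<in> {1, -1}" "0 \<le> \<tau>" "\<tau> \<le> \<delta>"
  shows "\<bar>sin (of_int n * (angle l + s * \<tau>))\<bar> = sin (of_int n * \<tau>)"
proof -
  have eq: "of_int n * (angle l + s * \<tau>) = s * (of_int n * \<tau>) + of_int l * pi"
    using n by (simp add: angle_def field_simps)
  have "of_int n * \<tau> \<le> of_int n * \<delta>" using n assms by (intro mult_left_mono) auto
  then have "of_int n * \<tau> \<le> pi" using \<delta> pi_gt_zero by linarith
  then have "sin (of_int n * \<tau>) \<ge> 0" using n assms by (intro sin_ge_zero) auto
  then show ?thesis unfolding eq abs_sin_add_int_pi using assms(1) by auto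
qed

lemma sin_n_mono:
  assumes "0 \<le> \<tau>0" "\<tau>0 \<le> \<tau>" "\<tau> \<le> \<delta>"
  shows "sin (of_int n * \<tau>0) \<le> sin (of_int n * \<tau>)"
proof -
  have "of_int n * \<tau>0 \<le> of_int n * \<tau>" "of_int n * \<tau> \<le> of_int n * \<delta>"
    using n assms by (auto intro!: mult_left_mono)
  moreover have "0 \<le> of_int n * \<tau>0" using n assms by auto
  ultimately show ?thesis using \<delta> pi_gt_zero by (intro sin_monotone_2pi_le) linarith+
qed

lemma sin_n_pos:
  assumes "0 < \<tau>" "\<tau> \<le> \<delta>"
  shows "sin (of_int n * \<tau>) > 0"
proof -
  have "of_int n * \<tau> \<le> of_int n * \<delta>" using n assms by (intro mult_left_mono) auto
  then have "of_int n * \<tau> < pi" using \<delta> pi_gt_zero by linarith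
  then show ?thesis using n assms by (intro sin_gt_zero) auto
qed

text \<open>An affine parametrisation of the interval from \<open>\<tau>0\<close> to \<delta> by the
  unit interval, on which \<open>trinomial_zeros_on_circle\<close> is stated.\<close>

definition offset :: "real \<Rightarrow> real \<Rightarrow> real" where "offset \<tau>0 x = \<tau>0 + x * (\<delta> - \<tau>0)"

lemma offset:
  assumes "0 < \<tau>0" "\<tau>0 < \<delta>" "x \<in> {0..1}"
  shows "\<tau>0 \<le> offset \<tau>0 x" "offset \<tau>0 x \<le> \<delta>"
proof -
  have "0 \<le> x * (\<delta> - \<tau>0)" "x * (\<delta> - \<tau>0) \<le> 1 * (\<delta> - \<tau>0)"
    using assms by (auto intro: mult_right_mono)
  then show "\<tau>0 \<le> offset \<tau>0 x" "offset \<tau>0 x \<le> \<delta>" by (auto simp: offset_def)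
qed

lemma offset_01 [simp]: "offset \<tau>0 0 = \<tau>0" "offset \<tau>0 1 = \<delta>"
  by (auto simp: offset_def)

lemma continuous_offset: "continuous_on S (\<lambda>x. sin (c * (a + s * offset \<tau>0 x)))"
  unfolding offset_def by (intro continuous_intros)

text \<open>The sign \<open>s\<close> selects a side of the angle; different \<open>u\<close> may
  occur at different \<tau>.\<close>

definition zeros_near :: "nat \<Rightarrow> int \<Rightarrow> real \<Rightarrow> real \<Rightarrow> complex set \<Rightarrow> bool" where
  "zeros_near c l s \<epsilon> U \<longleftrightarrow> finite U \<and> card U = c \<and> U \<subseteq> sphere 0 1 \<and>
     (\<forall>u\<in>U. \<exists>\<tau>. 0 < \<tau> \<and> \<tau> \<le> \<delta> \<and> trinomial \<epsilon> (angle l + s * \<tau>) u = 0)"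

text \<open>Moving away from the angle, \<bar>sin (n * t)\<bar> grows from nearly 0, where the
  middle coefficient dominates, to more than 1/2, where it dominates both others.\<close>

lemma zeros_near_simple:
  assumes s: "s \<in> {1, -1}" and nc: "sin (of_int m * angle l) \<noteq> 0"
  shows "\<exists>e>0. \<forall>\<epsilon>. 0 < \<epsilon> \<and> \<epsilon> < e \<longrightarrow> (\<exists>U. zeros_near M l s \<epsilon> U)"
proof -
  \<comment> \<open>Since the middle coefficient carries the factor 1/8, negativity of
    \<open>f\<close> puts the first coefficient below half of it and leaves room for the
    perturbation.\<close>
  define f where "f = (\<lambda>\<tau>. 16 * \<bar>sin (of_int n * (angle l + s * \<tau>))\<bar> - \<bar>sin (of_int m * (angle l + s * \<tau>))\<bar>)"
  have "isCont f 0" unfolding f_def by (intro continuous_intros)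
  moreover have "f 0 < 0"
    using abs_sin_n[OF s, of 0 l] \<delta> nc by (simp add: f_def)
  ultimately obtain \<tau>0 where \<tau>0: "0 < \<tau>0" "\<tau>0 < \<delta>" "f \<tau>0 < 0"
    using exists_neg_right_of_0[OF _ _ \<delta>(1)] by blast
  define S where "S = sin (of_int n * \<tau>0)"
  have S: "S > 0" using sin_n_pos[of \<tau>0] \<tau>0 by (simp add: S_def)
  have ff: "16 * S < \<bar>sin (of_int m * (angle l + s * \<tau>0))\<bar>"
    using \<tau>0 abs_sin_n[OF s, of \<tau>0 l] by (simp add: f_def S_def)
  \<comment> \<open>The bound \<open>S / 2\<close> keeps the perturbation below half the first
    coefficient on the whole window; 1/8 keeps the other two coefficients together below 1/4 at its
    far end.\<close>
  have "\<exists>U. zeros_near M l s \<epsilon> U" if \<epsilon>: "0 < \<epsilon>" "\<epsilon> < min (S / 2) (1 / 8)" for \<epsilon>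
  proof -
    define t where "t = (\<lambda>x. angle l + s * offset \<tau>0 x)"
    have C: "\<bar>\<epsilon> * sin y\<bar> \<le> \<epsilon>" for y using \<epsilon> by (simp add: abs_mult mult_left_le)
    have A: "\<bar>sin (of_int n * t x)\<bar> = sin (of_int n * offset \<tau>0 x)" "S \<le> \<bar>sin (of_int n * t x)\<bar>"
      if "x \<in> {0..1}" for x
    proof -
      have o: "\<tau>0 \<le> offset \<tau>0 x" "offset \<tau>0 x \<le> \<delta>" using offset[OF \<tau>0(1,2) that] .
      then show "\<bar>sin (of_int n * t x)\<bar> = sin (of_int n * offset \<tau>0 x)"
        unfolding t_def using \<tau>0 by (intro abs_sin_n[OF s]) auto
      then show "S \<le> \<bar>sin (of_int n * t x)\<bar>"
        using sin_n_mono[OF _ o] \<tau>0 by (simp add: S_def)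
    qed
    obtain U :: "complex set" where U: "finite U" "card U = M" "U \<subseteq> sphere 0 1"
      "\<And>u. u \<in> U \<Longrightarrow> \<exists>x\<in>{0..1}. of_real (sin (of_int n * t x)) * u ^ M + of_real (sin (of_int m * t x) / 8)
         + of_real (\<epsilon> * sin (of_int (m + 1) * t x)) * u powi 1 = 0"
    proof (rule trinomial_zeros_on_circle[of M "\<lambda>x. sin (of_int n * t x)" "\<lambda>x. sin (of_int m * t x) / 8"
          "\<lambda>x. \<epsilon> * sin (of_int (m + 1) * t x)" 1])
      show "continuous_on {0..1} (\<lambda>x. sin (of_int n * t x))"
        "continuous_on {0..1} (\<lambda>x. sin (of_int m * t x) / 8)"
        "continuous_on {0..1} (\<lambda>x. \<epsilon> * sin (of_int (m + 1) * t x))"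
        unfolding t_def by (intro continuous_intros continuous_offset; simp)+
      show "2 * \<bar>\<epsilon> * sin (of_int (m + 1) * t x)\<bar> < \<bar>sin (of_int n * t x)\<bar>" if "x \<in> {0..1}" for x
        using A(2)[OF that] C[of "of_int (m + 1) * t x"] \<epsilon> by linarith
      show "\<bar>sin (of_int n * t 0)\<bar> + \<bar>\<epsilon> * sin (of_int (m + 1) * t 0)\<bar> < \<bar>sin (of_int m * t 0) / 8\<bar>"
      proof -
        have "\<bar>sin (of_int n * t 0)\<bar> = S" using A(1)[of 0] by (simp add: S_def)
        moreover have "16 * S < \<bar>sin (of_int m * t 0)\<bar>" using ff by (simp add: t_def)
        moreover have "\<bar>sin (of_int m * t 0) / 8\<bar> = \<bar>sin (of_int m * t 0)\<bar> / 8" by simp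
        ultimately show ?thesis using C[of "of_int (m + 1) * t 0"] \<epsilon> S by linarith
      qed
      show "2 * (\<bar>sin (of_int m * t 1) / 8\<bar> + \<bar>\<epsilon> * sin (of_int (m + 1) * t 1)\<bar>) < \<bar>sin (of_int n * t 1)\<bar>"
      proof -
        have "\<bar>sin (of_int n * t 1)\<bar> > 1 / 2" using A(1)[of 1] \<delta>(2) sin_pi_3_gt by simp
        moreover have "\<bar>sin (of_int m * t 1) / 8\<bar> \<le> 1 / 8" using abs_sin_le_one[of "of_int m * t 1"] by simp
        moreover from this have "\<bar>sin (of_int m * t 1) / 8\<bar> + \<bar>\<epsilon> * sin (of_int (m + 1) * t 1)\<bar> < 1 / 4"
          using C[of "of_int (m + 1) * t 1"] \<epsilon> by linarith
        ultimately show ?thesis by (intro two_mult_less)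
      qed
    qed (rule M, blast)
    have "\<exists>\<tau>. 0 < \<tau> \<and> \<tau> \<le> \<delta> \<and> trinomial \<epsilon> (angle l + s * \<tau>) u = 0" if u: "u \<in> U" for u
    proof -
      obtain x where "x \<in> {0..1}" and x: "trinomial \<epsilon> (angle l + s * offset \<tau>0 x) u = 0"
        using U(4)[OF u] by (auto simp: trinomial_def t_def)
      then show ?thesis using offset[of \<tau>0 x] \<tau>0 by (intro exI[of _ "offset \<tau>0 x"]) auto
    qed
    then show ?thesis using U unfolding zeros_near_def by blast
  qed
  then show ?thesis using S by (intro exI[of _ "min (S / 2) (1 / 8)"]) auto
qed

text \<open>
  At a common zero of \<open>sin (n t)\<close> and \<open>sin (m t)\<close> the small third term is the one that balances
  \<open>sin (n t) u\<^sup>M\<close>, which leaves the effective exponent \<open>M - 1\<close>.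
\<close>
lemma zeros_near_common:
  assumes s: "s \<in> {1, -1}" and l: "0 < l" "l < n" and com: "sin (of_int m * angle l) = 0"
    and \<epsilon>: "0 < \<epsilon>" "\<epsilon> < 1 / 8"
  shows "\<exists>U. zeros_near (M - 1) l s \<epsilon> U"
proof (cases "M = 1")
  case True
  then show ?thesis by (intro exI[of _ "{}"]) (simp add: zeros_near_def)
next
  case False
  then have M1: "M - 1 \<ge> 1" using M by simp
  have al: "0 < angle l" "angle l < pi" using l n by (auto simp: angle_def field_simps)
  obtain r :: int where r: "of_int m * angle l = of_int r * pi"
    using com by (auto simp: sin_zero_iff_int2)
  \<comment> \<open>With \<open>abs_sin_int_mult_le\<close> this bounds \<bar>sin (m * t)\<bar> by
    \<bar>sin (n * t)\<bar> on the window.\<close>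
  have abs_m: "\<bar>sin (of_int m * (angle l + s * \<tau>))\<bar> = \<bar>sin (of_int m * \<tau>)\<bar>" for \<tau>
  proof -
    have "of_int m * (angle l + s * \<tau>) = s * (of_int m * \<tau>) + of_int r * pi"
      using r by (simp add: algebra_simps)
    then show ?thesis using s by (auto simp: abs_sin_add_int_pi)
  qed
  have sin_m1: "sin (of_int (m + 1) * angle l) \<noteq> 0"
  proof -
    have "of_int (m + 1) * angle l = angle l + of_int r * pi" using r by (simp add: algebra_simps)
    then have "\<bar>sin (of_int (m + 1) * angle l)\<bar> = \<bar>sin (angle l)\<bar>" by (simp only: abs_sin_add_int_pi)
    then show ?thesis using sin_gt_zero[OF al] by auto
  qed
  \<comment> \<open>Twice the first coefficient suffices, because the term with
    \<open>sin (m * t) / 8\<close> is at most an eighth of it.\<close>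
  define f where "f = (\<lambda>\<tau>. 2 * \<bar>sin (of_int n * (angle l + s * \<tau>))\<bar> - \<epsilon> * \<bar>sin (of_int (m + 1) * (angle l + s * \<tau>))\<bar>)"
  have "isCont f 0" unfolding f_def by (intro continuous_intros)
  moreover have "f 0 < 0"
    using abs_sin_n[OF s, of 0 l] \<delta> sin_m1 \<epsilon> by (simp add: f_def)
  ultimately obtain \<tau>0 where \<tau>0: "0 < \<tau>0" "\<tau>0 < \<delta>" "f \<tau>0 < 0"
    using exists_neg_right_of_0[OF _ _ \<delta>(1)] by blast
  define t where "t = (\<lambda>x. angle l + s * offset \<tau>0 x)"
  have A: "\<bar>sin (of_int n * t x)\<bar> = sin (of_int n * offset \<tau>0 x)" "\<bar>sin (of_int n * t x)\<bar> > 0"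
      "\<bar>sin (of_int m * t x)\<bar> \<le> \<bar>sin (of_int n * t x)\<bar>"
    if "x \<in> {0..1}" for x
  proof -
    have o: "\<tau>0 \<le> offset \<tau>0 x" "offset \<tau>0 x \<le> \<delta>" using offset[OF \<tau>0(1,2) that] .
    then show 1: "\<bar>sin (of_int n * t x)\<bar> = sin (of_int n * offset \<tau>0 x)"
      unfolding t_def using \<tau>0 by (intro abs_sin_n[OF s]) auto
    then show "\<bar>sin (of_int n * t x)\<bar> > 0"
      using sin_n_pos[of "offset \<tau>0 x"] o \<tau>0 by simp
    have "of_int n * offset \<tau>0 x \<le> of_int n * \<delta>" using n o by (intro mult_left_mono) auto
    then have "of_int n * offset \<tau>0 x \<le> pi / 2" using \<delta> pi_gt_zero by linarith
    then show "\<bar>sin (of_int m * t x)\<bar> \<le> \<bar>sin (of_int n * t x)\<bar>"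
      unfolding 1 unfolding t_def abs_m using mn o \<tau>0 by (intro abs_sin_int_mult_le) auto
  qed
  have C: "\<bar>sin (of_int m * t x) / 8\<bar> = \<bar>sin (of_int m * t x)\<bar> / 8" for x by simp
  \<comment> \<open>After division by \<open>u\<close> the \<epsilon> term becomes the constant one,
    and \<open>sin (m * t) / 8\<close> is the perturbation, with exponent \<open>-1\<close>.\<close>
  obtain U :: "complex set" where U: "finite U" "card U = M - 1" "U \<subseteq> sphere 0 1"
    "\<And>u. u \<in> U \<Longrightarrow> \<exists>x\<in>{0..1}. of_real (sin (of_int n * t x)) * u ^ (M - 1)
       + of_real (\<epsilon> * sin (of_int (m + 1) * t x)) + of_real (sin (of_int m * t x) / 8) * u powi (-1) = 0"
  proof (rule trinomial_zeros_on_circle[of "M - 1" "\<lambda>x. sin (of_int n * t x)"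
        "\<lambda>x. \<epsilon> * sin (of_int (m + 1) * t x)" "\<lambda>x. sin (of_int m * t x) / 8" "-1"])
    show "continuous_on {0..1} (\<lambda>x. sin (of_int n * t x))"
      "continuous_on {0..1} (\<lambda>x. \<epsilon> * sin (of_int (m + 1) * t x))"
      "continuous_on {0..1} (\<lambda>x. sin (of_int m * t x) / 8)"
      unfolding t_def by (intro continuous_intros continuous_offset; simp)+
    show "2 * \<bar>sin (of_int m * t x) / 8\<bar> < \<bar>sin (of_int n * t x)\<bar>" if "x \<in> {0..1}" for x
      unfolding C using A(2,3)[OF that] by linarith
    show "\<bar>sin (of_int n * t 0)\<bar> + \<bar>sin (of_int m * t 0) / 8\<bar> < \<bar>\<epsilon> * sin (of_int (m + 1) * t 0)\<bar>"
    proof -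
      have "2 * \<bar>sin (of_int n * t 0)\<bar> < \<bar>\<epsilon> * sin (of_int (m + 1) * t 0)\<bar>"
        using \<tau>0(3) \<epsilon> by (simp add: f_def t_def abs_mult)
      then show ?thesis unfolding C using A(3)[of 0] by simp
    qed
    show "2 * (\<bar>\<epsilon> * sin (of_int (m + 1) * t 1)\<bar> + \<bar>sin (of_int m * t 1) / 8\<bar>) < \<bar>sin (of_int n * t 1)\<bar>"
    proof -
      have "\<bar>sin (of_int n * t 1)\<bar> > 1 / 2" using A(1)[of 1] \<delta>(2) sin_pi_3_gt by simp
      moreover have "\<bar>sin (of_int m * t 1)\<bar> \<le> 1" by simp
      moreover have "\<bar>\<epsilon> * sin (of_int (m + 1) * t 1)\<bar> \<le> \<epsilon>" using \<epsilon> by (simp add: abs_mult mult_left_le)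
      ultimately have "\<bar>\<epsilon> * sin (of_int (m + 1) * t 1)\<bar> + \<bar>sin (of_int m * t 1) / 8\<bar> < 1 / 4"
        unfolding C using \<epsilon> by linarith
      then show ?thesis using \<open>\<bar>sin (of_int n * t 1)\<bar> > 1 / 2\<close> by (rule two_mult_less)
    qed
  qed (rule M1, blast)
  have "\<exists>\<tau>. 0 < \<tau> \<and> \<tau> \<le> \<delta> \<and> trinomial \<epsilon> (angle l + s * \<tau>) u = 0" if u: "u \<in> U" for u
  proof -
    obtain x where x: "x \<in> {0..1}" "of_real (sin (of_int n * t x)) * u ^ (M - 1)
       + of_real (\<epsilon> * sin (of_int (m + 1) * t x)) + of_real (sin (of_int m * t x) / 8) * u powi (-1) = 0"
      using U(4)[OF u] by blast
    have "u \<noteq> 0" using U(3) u by auto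
    then have "u ^ (M - 1) * u = u ^ M" "u powi (-1) * u = 1"
      using M1 by (simp_all flip: power_Suc2 add: power_int_minus)
    then have "trinomial \<epsilon> (t x) u = (of_real (sin (of_int n * t x)) * u ^ (M - 1)
       + of_real (\<epsilon> * sin (of_int (m + 1) * t x)) + of_real (sin (of_int m * t x) / 8) * u powi (-1)) * u"
      unfolding trinomial_def distrib_right mult.assoc by simp
    then have "trinomial \<epsilon> (angle l + s * offset \<tau>0 x) u = 0" unfolding x(2) by (simp add: t_def)
    then show ?thesis using offset[of \<tau>0 x] \<tau>0 x(1) by (intro exI[of _ "offset \<tau>0 x"]) auto
  qed
  then show ?thesis using U unfolding zeros_near_def by blast
qed

section \<open>The extremal Laurent polynomial and its self-intersections\<close>

definition P :: "real \<Rightarrow> laurent_poly" where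
  "P \<epsilon> = Poly_Mapping.single n 1 + Poly_Mapping.single m (1 / 8) + Poly_Mapping.single (m + 1) (of_real \<epsilon>)"

lemma lookup_P: "Poly_Mapping.lookup (P \<epsilon>) k =
    (if k = n then 1 else 0) + (if k = m then 1 / 8 else 0) + (if k = m + 1 then of_real \<epsilon> else 0)"
  by (auto simp: P_def lookup_add lookup_single when_def)

lemma P_laurent_polys:
  assumes "\<epsilon> > 0"
  shows "P \<epsilon> \<in> laurent_polys m n"
proof -
  have "m < n" using M by linarith
  \<comment> \<open>If \<open>m + 1 = n\<close>, the first and third terms merge and the leading
    coefficient is \<open>1 + \<epsilon>\<close>.\<close>
  have "(1::complex) + of_real \<epsilon> \<noteq> 0"
    using assms by (simp add: complex_eq_iff)
  then have "Poly_Mapping.lookup (P \<epsilon>) n \<noteq> 0" unfolding lookup_P using \<open>m < n\<close> by auto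
  moreover have "Poly_Mapping.lookup (P \<epsilon>) m \<noteq> 0" unfolding lookup_P using \<open>m < n\<close> by auto
  moreover have "Poly_Mapping.lookup (P \<epsilon>) k = 0" if "k \<notin> {m..n}" for k
    unfolding lookup_P using that \<open>m < n\<close> by auto
  ultimately show ?thesis
    unfolding laurent_polys_def by (simp add: subset_iff in_keys_iff) fastforce
qed

text \<open>The consecutive exponents \<open>m\<close> and \<open>m + 1\<close> exclude a common
  zero of the sines. If \<open>n = - m\<close>, then \<open>n\<close> differs from
  \<open>m + 1\<close> by parity, and the end coefficients 1 and 1/8 have different moduli.\<close>

lemma P_nonvanishing:
  assumes "\<epsilon> > 0"
  shows "\<not> power_composite (P \<epsilon>)" "\<not> balanced_ends m n (P \<epsilon>)"
proof -
  have "m < n" using M by linarith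
  have nz: "(1::complex) + of_real \<epsilon> \<noteq> 0"
    using assms by (simp add: complex_eq_iff)
  have keys: "n \<in> Poly_Mapping.keys (P \<epsilon>)" "m \<in> Poly_Mapping.keys (P \<epsilon>)" "m + 1 \<in> Poly_Mapping.keys (P \<epsilon>)"
    using \<open>m < n\<close> nz assms by (auto simp: in_keys_iff lookup_P)
  have "False" if t: "0 < t" "t < pi" and van: "\<forall>k\<in>Poly_Mapping.keys (P \<epsilon>). sin (of_int k * t) = 0" for t
  proof -
    have s: "sin (of_int m * t) = 0" "sin (of_int (m + 1) * t) = 0" using van keys by blast+
    have "sin t = sin (of_int (m + 1) * t - of_int m * t)" by (simp add: algebra_simps)
    also have "\<dots> = 0" unfolding sin_diff using s by simp
    finally show False using sin_gt_zero[OF t] by simp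
  qed
  then show "\<not> power_composite (P \<epsilon>)"
    using power_composite_iff[OF keys(1)] n by auto
  show "\<not> balanced_ends m n (P \<epsilon>)"
  proof
    assume b: "balanced_ends m n (P \<epsilon>)"
    then have "n = - m" by (simp add: balanced_ends_def)
    then have "n \<noteq> m + 1" by presburger
    then show False using b \<open>m < n\<close> by (simp add: balanced_ends_def lookup_P)
  qed
qed

lemma chord_solutions_P:
  assumes "\<epsilon> > 0" "0 < t" "t < pi" "u \<in> sphere 0 1" "trinomial \<epsilon> t u = 0"
  shows "(t, u) \<in> chord_solutions (P \<epsilon>)"
proof -
  have mn': "m < n" using M by linarith
  have u: "u \<noteq> 0" using assms by auto
  define g where "g = (\<lambda>k. u powi k * complex_of_real (sin (of_int k * t)))"
  have "(\<Sum>k\<in>Poly_Mapping.keys (P \<epsilon>). Poly_Mapping.lookup (P \<epsilon>) k * u powi k * of_real (sin (of_int k * t)))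
      = (\<Sum>k\<in>{m..n}. Poly_Mapping.lookup (P \<epsilon>) k * u powi k * of_real (sin (of_int k * t)))"
    using P_laurent_polys[OF assms(1)]
    by (intro sum.mono_neutral_left) (auto simp: laurent_polys_def in_keys_iff)
  also have "\<dots> = (\<Sum>k\<in>{m..n}. (if k = n then g k else 0) + (if k = m then g k / 8 else 0) + (if k = m + 1 then of_real \<epsilon> * g k else 0))"
    by (intro sum.cong refl) (auto simp: lookup_P g_def algebra_simps)
  also have "\<dots> = g n + g m / 8 + of_real \<epsilon> * g (m + 1)"
    using mn' by (simp add: sum.distrib sum.delta')
  also have "\<dots> = u powi m * trinomial \<epsilon> t u"
  proof -
    have "n = m + int M" using M by simp
    then have "u powi n = u powi m * u ^ M" using u power_int_add[of u m "int M"] by simp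
    moreover have "u powi (m + 1) = u powi m * u" using u by (simp add: power_int_add)
    ultimately show ?thesis by (simp only: g_def trinomial_def) (simp add: algebra_simps)
  qed
  finally show ?thesis using assms by (auto simp: chord_solutions_def)
qed

text \<open>\<open>sin (m * angle l)\<close> vanishes only if \<open>n\<close> divides
  \<open>m * l\<close>, hence only if \<open>n / gcd n m\<close> divides \<open>l\<close>.\<close>

lemma card_common_le: "card {l \<in> {1..n-1}. sin (of_int m * angle l) = 0} \<le> nat (gcd n m - 1)"
proof -
  define e where "e = gcd n m"
  obtain n' where n': "n = e * n'" unfolding e_def by (meson dvdE gcd_dvd1)
  obtain m' where m': "m = e * m'" unfolding e_def by (meson dvdE gcd_dvd2)
  have e: "e > 0" using n by (simp add: e_def)
  have cop: "coprime n' m'"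
  proof -
    have "gcd n m = \<bar>e\<bar> * gcd n' m'" by (subst n', subst m') (simp add: gcd_mult_left abs_mult)
    then have "gcd n' m' = 1" using e n by (auto simp: e_def)
    then show ?thesis by (simp add: coprime_iff_gcd_eq_1)
  qed
  have n'0: "n' > 0" using n n' e by (simp add: zero_less_mult_iff)
  have "{l \<in> {1..n-1}. sin (of_int m * angle l) = 0} \<subseteq> (\<lambda>i. n' * i) ` {1..e - 1}"
  proof
    fix l assume "l \<in> {l \<in> {1..n-1}. sin (of_int m * angle l) = 0}"
    then have l: "1 \<le> l" "l < n" and "sin (of_int m * angle l) = 0" by auto
    then obtain r :: int where "of_int m * angle l = of_int r * pi" by (auto simp: sin_zero_iff_int2)
    then have "real_of_int (m * l) = real_of_int (r * n)"
      using n by (simp add: angle_def field_simps)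
    then have "m * l = r * n" by (simp only: of_int_eq_iff)
    then have "e * (m' * l) = e * (r * n')" by (metis m' n' mult.assoc mult.left_commute)
    then have "m' * l = r * n'" using e by simp
    then have "n' dvd m' * l" by simp
    then have "n' dvd l" using cop by (simp add: coprime_dvd_mult_right_iff)
    then obtain i where i: "l = n' * i" ..
    have "i \<ge> 1" using l(1) n'0 unfolding i by (metis int_one_le_iff_zero_less zero_less_mult_pos zero_less_mult_iff less_le_trans zero_less_one)
    moreover have "n' * i < n' * e" using l(2) unfolding i by (metis n' mult.commute)
    then have "i < e" using n'0 by simp
    ultimately show "l \<in> (\<lambda>i. n' * i) ` {1..e - 1}" using i by auto
  qed
  then have "card {l \<in> {1..n-1}. sin (of_int m * angle l) = 0} \<le> card ((\<lambda>i. n' * i) ` {1..e - 1})"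
    by (intro card_mono) auto
  also have "\<dots> \<le> card {1..e - 1}" by (rule card_image_le) simp
  finally show ?thesis by (simp add: e_def)
qed

definition zero_count :: "int \<Rightarrow> nat" where
  "zero_count l = (if sin (of_int m * angle l) = 0 then M - 1 else M)"

lemma sum_zero_count_ge: "int (\<Sum>l\<in>{1..n-1}. zero_count l) \<ge> sigma_bound m n"
proof -
  let ?C = "{l \<in> {1..n-1}. sin (of_int m * angle l) = 0}"
  have "int (\<Sum>l\<in>{1..n-1}. zero_count l) = (\<Sum>l\<in>{1..n-1}. (n - m) - (if sin (of_int m * angle l) = 0 then 1 else 0))"
    unfolding of_nat_sum using M by (intro sum.cong refl) (auto simp: zero_count_def of_nat_diff)
  also have "\<dots> = (n - 1) * (n - m) - int (card ?C)"
    using n by (simp add: sum_subtractf sum.If_cases Int_def)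
  also have "\<dots> \<ge> (n - 1) * (n - m) - (gcd n m - 1)"
  proof -
    have "gcd n m > 0" using n by simp
    then have "int (nat (gcd n m - 1)) = gcd n m - 1" by linarith
    then show ?thesis using card_common_le by linarith
  qed
  finally show ?thesis by (simp add: sigma_bound_def)
qed

text \<open>There are finitely many pairs \<open>(l, s)\<close>, so one \<epsilon> below all their
  thresholds serves.\<close>

lemma exists_zeros_near:
  obtains \<epsilon> where "\<epsilon> > 0" "\<And>l s. l \<in> {1..n-1} \<Longrightarrow> s \<in> {1, -1} \<Longrightarrow> \<exists>U. zeros_near (zero_count l) l s \<epsilon> U"
proof -
  let ?I = "{1..n-1} \<times> {1, -1 :: real}"
  have "\<exists>e>0. \<forall>\<epsilon>. 0 < \<epsilon> \<and> \<epsilon> < e \<longrightarrow> (\<exists>U. zeros_near (zero_count (fst i)) (fst i) (snd i) \<epsilon> U)" if "i \<in> ?I" for i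
  proof (cases "sin (of_int m * angle (fst i)) = 0")
    case True
    have "0 < fst i" "fst i < n" "snd i \<in> {1, -1}" using that by auto
    from zeros_near_common[OF this(3,1,2) True] show ?thesis
      using True by (intro exI[of _ "1 / 8"]) (auto simp: zero_count_def)
  next
    case False
    have "snd i \<in> {1, -1}" using that by auto
    from zeros_near_simple[OF this False] show ?thesis using False by (simp add: zero_count_def)
  qed
  then obtain e where e: "\<And>i. i \<in> ?I \<Longrightarrow> e i > 0"
    "\<And>i \<epsilon>. i \<in> ?I \<Longrightarrow> 0 < \<epsilon> \<Longrightarrow> \<epsilon> < e i \<Longrightarrow> \<exists>U. zeros_near (zero_count (fst i)) (fst i) (snd i) \<epsilon> U"
    by metis
  define E where "E = Min (insert 1 (e ` ?I))"
  have "E > 0" unfolding E_def using e(1) by (subst Min_gr_iff) auto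
  then have E1: "0 < E / 2" by simp
  have E2: "E / 2 < e i" if "i \<in> ?I" for i
  proof -
    have "E \<le> e i" unfolding E_def using that by (intro Min_le) auto
    then show ?thesis using \<open>E > 0\<close> by linarith
  qed
  have "\<exists>U. zeros_near (zero_count l) l s (E / 2) U" if "l \<in> {1..n-1}" "s \<in> {1, -1}" for l s
  proof -
    have "(l, s) \<in> ?I" using that by auto
    from e(2)[OF this E1 E2[OF this]] show ?thesis by simp
  qed
  then show ?thesis using E1 by (rule that[rotated])
qed

lemma angle_offset_inj:
  assumes \<tau>: "0 < \<tau>" "\<tau> \<le> \<delta>" "0 < \<tau>'" "\<tau>' \<le> \<delta>" and s: "s \<in> {1, -1}" "s' \<in> {1, -1}"
    and eq: "angle l + s * \<tau> = angle l' + s' * \<tau>'"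
  shows "l = l' \<and> s = s'"
proof -
  \<comment> \<open>In units of \<open>\<delta>\<close> the angles are multiples of 3 and the
    offsets are at most 1, so equal sums come from the same angle and the same side.\<close>
  define x where "x = 3 * of_int n * \<tau> / pi"
  define x' where "x' = 3 * of_int n * \<tau>' / pi"
  have x: "0 < x" "x \<le> 1" "0 < x'" "x' \<le> 1"
    using \<tau> n by (auto simp: x_def x'_def \<delta>_def field_simps)
  have "3 * of_int n / pi * (angle l + s * \<tau>) = 3 * of_int n / pi * (angle l' + s' * \<tau>')" using eq by simp
  moreover have "3 * of_int n / pi * angle k = 3 * of_int k" for k
    using n by (simp add: angle_def)
  moreover have "3 * of_int n / pi * (s * \<tau>) = s * x" "3 * of_int n / pi * (s' * \<tau>') = s' * x'"
    by (simp_all add: x_def x'_def)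
  ultimately have eq': "3 * of_int l + s * x = 3 * of_int l' + s' * x'"
    by (simp only: distrib_left)
  have "\<bar>s * x\<bar> \<le> 1" "\<bar>s' * x'\<bar> \<le> 1" using s x by auto
  then have "\<bar>3 * real_of_int (l - l')\<bar> \<le> 2" using eq' by simp
  then have "\<bar>real_of_int (l - l')\<bar> < 1" by (simp add: abs_mult)
  then have "l = l'" by linarith
  moreover have "s = s'" using eq' s x \<open>l = l'\<close> by auto
  ultimately show ?thesis by simp
qed

lemma angle_offset_range:
  assumes \<tau>: "0 < \<tau>" "\<tau> \<le> \<delta>" and s: "s \<in> {1, -1}" and l: "l \<in> {1..n-1}"
  shows "0 < angle l + s * \<tau>" "angle l + s * \<tau> < pi"
proof -
  define w where "w = pi / of_int n"
  have w: "w > 0" "of_int n * w = pi" "\<delta> < w" "angle l = of_int l * w"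
    using n by (auto simp: w_def \<delta>_def angle_def field_simps)
  have "w \<le> of_int l * w" using l w mult_right_mono[of 1 "real_of_int l" w] by simp
  moreover have "of_int l * w \<le> of_int (n - 1) * w" using l w by (intro mult_right_mono) auto
  moreover have "of_int (n - 1) * w = pi - w" using w(2) by (simp add: left_diff_distrib)
  moreover have "\<bar>s * \<tau>\<bar> = \<tau>" using s \<tau> by auto
  ultimately show "0 < angle l + s * \<tau>" "angle l + s * \<tau> < pi"
    unfolding w(4) using \<tau> w(1,3) by linarith+
qed

text \<open>The zeros on the two sides of all angles are distinct chord solutions, at least
  \<open>2 * sigma_bound m n\<close> in number. Each self-intersection accounts for two of them, and
  the upper bound gives equality.\<close>

lemma exists_extremal_laurent_poly:
  "\<exists>p\<in>laurent_polys m n. \<not> power_composite p \<and> \<not> balanced_ends m n p \<and>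
     finite (self_intersections p) \<and> int (card (self_intersections p)) = sigma_bound m n"
proof -
  obtain \<epsilon> where \<epsilon>: "\<epsilon> > 0" "\<And>l s. l \<in> {1..n-1} \<Longrightarrow> s \<in> {1, -1} \<Longrightarrow> \<exists>U. zeros_near (zero_count l) l s \<epsilon> U"
    using exists_zeros_near by blast
  then obtain U where U: "\<And>l s. l \<in> {1..n-1} \<Longrightarrow> s \<in> {1, -1} \<Longrightarrow> zeros_near (zero_count l) l s \<epsilon> (U l s)"
    by metis
  define I where "I = {1..n-1} \<times> {1, -1 :: real}"
  define V where "V = Sigma I (\<lambda>(l, s). U l s)"
  have "\<exists>\<tau>. 0 < \<tau> \<and> \<tau> \<le> \<delta> \<and> trinomial \<epsilon> (angle l + s * \<tau>) u = 0" if "((l, s), u) \<in> V" for l s u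
    using U[of l s] that by (auto simp: V_def I_def zeros_near_def)
  then obtain \<tau> where \<tau>: "\<And>l s u. ((l, s), u) \<in> V \<Longrightarrow>
      0 < \<tau> l s u \<and> \<tau> l s u \<le> \<delta> \<and> trinomial \<epsilon> (angle l + s * \<tau> l s u) u = 0"
    by metis
  define G where "G = (\<lambda>((l, s), u). (angle l + s * \<tau> l s u, u))"
  have "inj_on G V"
  proof (rule inj_onI)
    fix v v' assume v: "v \<in> V" "v' \<in> V" "G v = G v'"
    obtain l s u l' s' u' where eq: "v = ((l, s), u)" "v' = ((l', s'), u')" by (metis surj_pair)
    have "s \<in> {1, -1}" "s' \<in> {1, -1}" using v eq by (auto simp: V_def I_def)
    moreover have "angle l + s * \<tau> l s u = angle l' + s' * \<tau> l' s' u'" "u = u'"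
      using v(3) by (auto simp: G_def eq)
    ultimately show "v = v'"
      using angle_offset_inj \<tau>[of l s u] \<tau>[of l' s' u'] v(1,2) unfolding eq by blast
  qed
  moreover have "G ` V \<subseteq> chord_solutions (P \<epsilon>)"
  proof (rule image_subsetI)
    fix v assume "v \<in> V"
    then obtain l s u where "v = ((l, s), u)" and v: "((l, s), u) \<in> V" by (metis surj_pair)
    then have ls: "l \<in> {1..n-1}" "s \<in> {1, -1}" "u \<in> U l s" by (auto simp: V_def I_def)
    then have "u \<in> sphere 0 1" using U[of l s] by (auto simp: zeros_near_def)
    then show "G v \<in> chord_solutions (P \<epsilon>)"
      using \<tau>[OF v] angle_offset_range[OF _ _ ls(2,1)] \<epsilon>(1) by (auto simp: G_def \<open>v = _\<close> intro!: chord_solutions_P)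
  qed
  moreover have upper: "finite (self_intersections (P \<epsilon>))" "int (card (self_intersections (P \<epsilon>))) \<le> sigma_bound m n"
    using self_intersections_upper_bound[OF mn P_laurent_polys[OF \<epsilon>(1)] P_nonvanishing[OF \<epsilon>(1)]] by auto
  have fin: "finite (chord_solutions (P \<epsilon>))"
    using chord_solutions_bound[OF mn P_laurent_polys[OF \<epsilon>(1)] P_nonvanishing[OF \<epsilon>(1)]] by blast
  ultimately have "card V \<le> card (chord_solutions (P \<epsilon>))"
    by (intro card_inj_on_le)
  also have "\<dots> = 2 * card (self_intersections (P \<epsilon>))" by (rule card_chord_solutions(2)[OF fin])
  finally have "card V \<le> 2 * card (self_intersections (P \<epsilon>))" .
  moreover have "card V = 2 * (\<Sum>l\<in>{1..n-1}. zero_count l)"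
  proof -
    have "card V = (\<Sum>i\<in>I. card (case i of (l, s) \<Rightarrow> U l s))"
      unfolding V_def by (rule card_SigmaI) (use U in \<open>auto simp: I_def zeros_near_def\<close>)
    also have "\<dots> = (\<Sum>i\<in>I. zero_count (fst i))"
      by (intro sum.cong refl) (use U in \<open>auto simp: I_def zeros_near_def\<close>)
    also have "\<dots> = (\<Sum>l\<in>{1..n-1}. \<Sum>s\<in>{1, -1 :: real}. zero_count l)"
      unfolding I_def by (simp only: sum.cartesian_product' fst_conv)
    finally show ?thesis by (simp add: sum_distrib_left mult_2)
  qed
  ultimately have "(\<Sum>l\<in>{1..n-1}. zero_count l) \<le> card (self_intersections (P \<epsilon>))" by simp
  then have "int (\<Sum>l\<in>{1..n-1}. zero_count l) \<le> int (card (self_intersections (P \<epsilon>)))"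
    by (simp only: of_nat_le_iff)
  then have "int (card (self_intersections (P \<epsilon>))) = sigma_bound m n"
    using sum_zero_count_ge upper(2) by linarith
  then show ?thesis
    using P_laurent_polys[OF \<epsilon>(1)] P_nonvanishing[OF \<epsilon>(1)] upper(1) by blast
qed

end

theorem theorem1p1:
  fixes m n :: int
  assumes "n \<ge> \<bar>m\<bar>" and "\<bar>m\<bar> \<ge> 1"
  shows "(\<forall>p \<in> laurent_polys m n.
            \<not> power_composite p \<and> \<not> balanced_ends m n p \<longrightarrow>
            finite (self_intersections p) \<and>
            int (card (self_intersections p)) \<le> sigma_bound m n) \<and>
         (n \<noteq> m \<longrightarrow>
          (\<exists>p \<in> laurent_polys m n.
            \<not> power_composite p \<and> \<not> balanced_ends m n p \<and>
            finite (self_intersections p) \<and>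
            int (card (self_intersections p)) = sigma_bound m n))"
proof (intro conjI ballI impI)
  fix p assume "p \<in> laurent_polys m n" "\<not> power_composite p \<and> \<not> balanced_ends m n p"
  then show "finite (self_intersections p)" "int (card (self_intersections p)) \<le> sigma_bound m n"
    using self_intersections_upper_bound[OF assms] by auto
next
  assume "n \<noteq> m"
  then interpret extremal m n using assms by unfold_locales auto
  show "\<exists>p \<in> laurent_polys m n. \<not> power_composite p \<and> \<not> balanced_ends m n p \<and>
      finite (self_intersections p) \<and> int (card (self_intersections p)) = sigma_bound m n"
    by (rule exists_extremal_laurent_poly)
qed

end
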